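(* Rooted weak bisimilarity $\sim_{\mathtt{RWB}}$ has no finite, complete axiomatisation over CCS; that is, there is no finite set $\mathcal{E}$ of equations between CCS terms (possibly containing variables) such that every equation in $\mathcal{E}$ is sound modulo $\sim_{\mathtt{RWB}}$ and every equation $t \approx u$ between CCS terms that is sound modulo $\sim_{\mathtt{RWB}}$ is derivable from $\mathcal{E}$ by the rules of equational logic.
   Context: Let $\mathcal{A}$ be a nonempty set of action names, $\overline{\mathcal{A}}=\{\overline{a}\mid a\in\mathcal{A}\}$ the co-names (with $\overline{\overline{a}}=a$, $a\neq\overline{a}$), and $\mathcal{A}_\tau=\mathcal{A}\cup\overline{\mathcal{A}}\cup\{\tau\}$. CCS terms (the recursion-, restriction- and relabelling-free fragment) are given by $t ::= \mathbf{0} \mid x \mid \mu.t \mid t+t \mid t\,\|\,t$ with $x$ from a countably infinite set of variables and $\mu\in\mathcal{A}_\tau$; closed terms are processes. The transition relation on processes is given by: $\mu.p\xrightarrow{\mu}p$; if $p\xrightarrow{\mu}p'$ then $p+q\xrightarrow{\mu}p'$, $q+p\xrightarrow{\mu}p'$, $p\|q\xrightarrow{\mu}p'\|q$ and $q\|p\xrightarrow{\mu}q\|p'$; if $p\xrightarrow{\alpha}p'$ and $q\xrightarrow{\overline{\alpha}}q'$ with $\alpha\in\mathcal{A}\cup\overline{\mathcal{A}}$, then $p\|q\xrightarrow{\tau}p'\|q'$. Let $\xrightarrow{\varepsilon}$ be the reflexive-transitive closure of $\xrightarrow{\tau}$; $p\xRightarrow{\mu}q$ means $p\xrightarrow{\varepsilon}\xrightarrow{\mu}\xrightarrow{\varepsilon}q$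 if $\mu\neq\tau$ and $p\xrightarrow{\varepsilon}q$ if $\mu=\tau$; $p\xRightarrow{\hat\mu}q$ means $p\xrightarrow{\varepsilon}\xrightarrow{\mu}\xrightarrow{\varepsilon}q$. Weak bisimilarity $\sim_{\mathtt{WB}}$ is the largest symmetric relation such that if $p\sim_{\mathtt{WB}}q$ and $p\xrightarrow{\mu}p'$ then either $\mu=\tau$ and $p'\sim_{\mathtt{WB}}q$, or $q\xRightarrow{\mu}q'$ with $p'\sim_{\mathtt{WB}}q'$. Rooted weak bisimilarity $\sim_{\mathtt{RWB}}$ is the symmetric relation such that $p\sim_{\mathtt{RWB}}q$ iff whenever $p\xrightarrow{\mu}p'$ there is $q'$ with $q\xRightarrow{\hat\mu}q'$ and $p'\sim_{\mathtt{WB}}q'$, and symmetrically for $q$. An equation $t\approx u$ is sound modulo $\sim_{\mathtt{RWB}}$ if $\sigma(t)\sim_{\mathtt{RWB}}\sigma(u)$ for every closed substitution $\sigma$. Equational logic: reflexivity, symmetry, transitivity, closure under substitution instances of axioms, and congruence rules for $\mu.\,\cdot$, $+$ and $\|$. *)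

theory Defs
  imports Main
begin

text \<open>The type parameter \<open>'a\<close> is the (arbitrary, nonempty) set of action names.\<close>

datatype 'a label = Name 'a | CoName 'a

fun co :: "'a label \<Rightarrow> 'a label" where
  "co (Name a) = CoName a"
| "co (CoName a) = Name a"

datatype 'a action = Vis "'a label" | Tau

datatype 'a ccs =
    Zero
  | Var nat
  | Prefix "'a action" "'a ccs"
  | Choice "'a ccs" "'a ccs"
  | Par "'a ccs" "'a ccs"

fun vars :: "'a ccs \<Rightarrow> nat set" where
  "vars Zero = {}"
| "vars (Var x) = {x}"
| "vars (Prefix \<mu> t) = vars t"
| "vars (Choice t u) = vars t \<union> vars u"
| "vars (Par t u) = vars t \<union> vars u"

definition process :: "'a ccs \<Rightarrow> bool" where
  "process t \<longleftrightarrow> vars t = {}"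

fun subst :: "(nat \<Rightarrow> 'a ccs) \<Rightarrow> 'a ccs \<Rightarrow> 'a ccs" where
  "subst \<sigma> Zero = Zero"
| "subst \<sigma> (Var x) = \<sigma> x"
| "subst \<sigma> (Prefix \<mu> t) = Prefix \<mu> (subst \<sigma> t)"
| "subst \<sigma> (Choice t u) = Choice (subst \<sigma> t) (subst \<sigma> u)"
| "subst \<sigma> (Par t u) = Par (subst \<sigma> t) (subst \<sigma> u)"

text \<open>The rules are stated for arbitrary terms, but only transitions of processes are ever
  used: both bisimilarities below relate processes only, and processes are closed under
  transitions (lemma \<open>process_step\<close>).\<close>

inductive step :: "'a ccs \<Rightarrow> 'a action \<Rightarrow> 'a ccs \<Rightarrow> bool" where
  prefix: "step (Prefix \<mu> p) \<mu> p"
| choiceL: "step p \<mu> p' \<Longrightarrow> step (Choice p q) \<mu> p'"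
| choiceR: "step p \<mu> p' \<Longrightarrow> step (Choice q p) \<mu> p'"
| parL: "step p \<mu> p' \<Longrightarrow> step (Par p q) \<mu> (Par p' q)"
| parR: "step p \<mu> p' \<Longrightarrow> step (Par q p) \<mu> (Par q p')"
| comm: "step p (Vis \<alpha>) p' \<Longrightarrow> step q (Vis (co \<alpha>)) q' \<Longrightarrow> step (Par p q) Tau (Par p' q')"

lemma process_step: "step p \<mu> p' \<Longrightarrow> process p \<Longrightarrow> process p'"
  by (induction rule: step.induct) (auto simp: process_def)

definition eps :: "'a ccs \<Rightarrow> 'a ccs \<Rightarrow> bool" where
  "eps = (\<lambda>p q. step p Tau q)\<^sup>*\<^sup>*"

text \<open>Convention: it is the hatted relation, here \<open>weak_step\<close>, that always performs at least
  one step; the unhatted one, here \<open>weak\<close>, may be empty for the silent action.\<close>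

definition weak_step :: "'a ccs \<Rightarrow> 'a action \<Rightarrow> 'a ccs \<Rightarrow> bool" where
  "weak_step p \<mu> q \<longleftrightarrow> (\<exists>r s. eps p r \<and> step r \<mu> s \<and> eps s q)"

definition weak :: "'a ccs \<Rightarrow> 'a action \<Rightarrow> 'a ccs \<Rightarrow> bool" where
  "weak p \<mu> q \<longleftrightarrow> (if \<mu> = Tau then eps p q else weak_step p \<mu> q)"

definition weak_bisimulation :: "('a ccs \<Rightarrow> 'a ccs \<Rightarrow> bool) \<Rightarrow> bool" where
  "weak_bisimulation R \<longleftrightarrow>
     (\<forall>p q. R p q \<longrightarrow> process p \<and> process q) \<and>
     symp R \<and>
     (\<forall>p q \<mu> p'. R p q \<and> step p \<mu> p' \<longrightarrow>
        \<mu> = Tau \<and> R p' q \<or> (\<exists>q'. weak q \<mu> q' \<and> R p' q'))"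

definition WB :: "'a ccs \<Rightarrow> 'a ccs \<Rightarrow> bool" where
  "WB p q \<longleftrightarrow> (\<exists>R. weak_bisimulation R \<and> R p q)"

text \<open>\<open>WB\<close> is indeed the largest weak bisimulation.\<close>

lemma weak_bisimulation_WB: "weak_bisimulation WB"
proof -
  have "process p \<and> process q" if "WB p q" for p q :: "'a ccs"
    using that by (auto simp: WB_def weak_bisimulation_def)
  moreover have "symp (WB :: 'a ccs \<Rightarrow> 'a ccs \<Rightarrow> bool)"
  proof (rule sympI)
    fix p q :: "'a ccs"
    assume "WB p q"
    then obtain R where R: "weak_bisimulation R" "R p q" by (auto simp: WB_def)
    from R(1) have "symp R" by (simp add: weak_bisimulation_def)
    from sympD[OF this R(2)] R(1) show "WB q p" by (auto simp: WB_def)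
  qed
  moreover have "\<mu> = Tau \<and> WB p' q \<or> (\<exists>q'. weak q \<mu> q' \<and> WB p' q')"
    if "WB p q" and t: "step p \<mu> p'" for p q p' :: "'a ccs" and \<mu>
  proof -
    from \<open>WB p q\<close> obtain R where R: "weak_bisimulation R" "R p q" by (auto simp: WB_def)
    with t have "\<mu> = Tau \<and> R p' q \<or> (\<exists>q'. weak q \<mu> q' \<and> R p' q')"
      by (simp add: weak_bisimulation_def)
    moreover have "WB x y" if "R x y" for x y
      using R(1) that by (auto simp: WB_def)
    ultimately show ?thesis by metis
  qed
  ultimately show ?thesis
    unfolding weak_bisimulation_def by metis
qed

lemma WB_largest: "weak_bisimulation R \<Longrightarrow> R p q \<Longrightarrow> WB p q"
  unfolding WB_def by (intro exI conjI)

definition RWB :: "'a ccs \<Rightarrow> 'a ccs \<Rightarrow> bool" where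
  "RWB p q \<longleftrightarrow> process p \<and> process q \<and>
     (\<forall>\<mu> p'. step p \<mu> p' \<longrightarrow> (\<exists>q'. weak_step q \<mu> q' \<and> WB p' q')) \<and>
     (\<forall>\<mu> q'. step q \<mu> q' \<longrightarrow> (\<exists>p'. weak_step p \<mu> p' \<and> WB p' q'))"

definition sound :: "'a ccs \<Rightarrow> 'a ccs \<Rightarrow> bool" where
  "sound t u \<longleftrightarrow> (\<forall>\<sigma>. (\<forall>x. process (\<sigma> x)) \<longrightarrow> RWB (subst \<sigma> t) (subst \<sigma> u))"

inductive derivable :: "('a ccs \<times> 'a ccs) set \<Rightarrow> 'a ccs \<Rightarrow> 'a ccs \<Rightarrow> bool"
  for E :: "('a ccs \<times> 'a ccs) set" where
  refl: "derivable E t t"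
| sym: "derivable E t u \<Longrightarrow> derivable E u t"
| trans: "derivable E t u \<Longrightarrow> derivable E u v \<Longrightarrow> derivable E t v"
| inst: "(t, u) \<in> E \<Longrightarrow> derivable E (subst \<sigma> t) (subst \<sigma> u)"
| prefix: "derivable E t u \<Longrightarrow> derivable E (Prefix \<mu> t) (Prefix \<mu> u)"
| choice: "derivable E t u \<Longrightarrow> derivable E t' u' \<Longrightarrow> derivable E (Choice t t') (Choice u u')"
| par: "derivable E t u \<Longrightarrow> derivable E t' u' \<Longrightarrow> derivable E (Par t t') (Par u u')"

end

theory Submission
  imports Defs
begin

text \<open>
  Write \<open>a\<close> for a fixed action and \<open>\<phi>\<^sub>n = a + a\<^sup>2 + \<dots> + a\<^sup>n\<close>. The sound equations
  \<open>a \<parallel> \<phi>\<^sub>n \<approx> a.\<phi>\<^sub>n + (a\<^sup>2 + \<dots> + a\<^bsup>n+1\<^esup>)\<close> cannot all follow from finitely many sound ones: axioms smaller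
  than \<open>n\<close> preserve, up to parallel components bisimilar to \<open>0\<close>, the presence of a summand
  \<open>p \<parallel> q\<close> with \<open>p\<close> bisimilar to \<open>a\<close> and \<open>q\<close> to \<open>\<phi>\<^sub>n\<close>.

  If an instance \<open>\<sigma> t\<close> of a side \<open>t\<close> has such a summand, then either it is contributed by a
  variable exposed at the top of \<open>t\<close>, or it arises from a subterm \<open>t' \<parallel> t''\<close>. In the latter
  case \<open>t''\<close> has fewer than \<open>n\<close> summands, so by the pigeonhole principle some variable \<open>x\<close>
  exposed in \<open>t''\<close> has two derivatives \<open>a\<^sup>i\<close> and \<open>a\<^sup>j\<close> with \<open>i \<noteq> j\<close>. Either way, adding the
  summand \<open>a.a\<^sup>N\<close> with \<open>N\<close> large to \<open>\<sigma> x\<close> shows that in the other side \<open>x\<close> must be exposed next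
  to parallel partners of the same total depth (\<open>0\<close> or \<open>1\<close>). A process with two such different
  derivatives is no power of \<open>a\<close>, which forces the summand of the other side to be split in
  the same way.
\<close>

section \<open>Weak transitions and congruence\<close>

lemma eps_refl [simp]: "eps p p"
  by (simp add: eps_def)

lemma eps_trans: "eps p q \<Longrightarrow> eps q r \<Longrightarrow> eps p r"
  by (simp add: eps_def)

lemma eps_step: "step p Tau q \<Longrightarrow> eps p q"
  by (auto simp: eps_def)

lemma eps_induct [consumes 1, case_names refl step]:
  assumes "eps p q" "P p" "\<And>r s. eps p r \<Longrightarrow> step r Tau s \<Longrightarrow> P r \<Longrightarrow> P s"
  shows "P q"
  using assms(1) unfolding eps_def
  by (induction rule: rtranclp_induct) (use assms(2,3) in \<open>auto simp: eps_def\<close>)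

lemma eps_stable: "eps p q \<Longrightarrow> \<forall>r. \<not> step p Tau r \<Longrightarrow> q = p"
  by (induction rule: eps_induct) auto

lemma weak_step_step: "step p \<mu> q \<Longrightarrow> weak_step p \<mu> q"
  unfolding weak_step_def by (meson eps_refl)

lemma weak_step_eps: "eps p q \<Longrightarrow> weak_step q \<mu> r \<Longrightarrow> eps r s \<Longrightarrow> weak_step p \<mu> s"
  unfolding weak_step_def by (meson eps_trans)

lemma weak_step_stable:
  assumes "weak_step p \<mu> q" "\<forall>r. \<not> step p Tau r"
  obtains r where "step p \<mu> r" "eps r q"
  using assms unfolding weak_step_def by (metis eps_stable)

lemma weak_Tau [simp]: "weak p Tau q \<longleftrightarrow> eps p q"
  by (simp add: weak_def)

lemma weak_Vis [simp]: "weak p (Vis l) q \<longleftrightarrow> weak_step p (Vis l) q"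
  by (simp add: weak_def)

lemma weak_step_imp_weak: "weak_step p \<mu> q \<Longrightarrow> weak p \<mu> q"
  by (cases \<mu>) (auto simp: weak_step_def dest!: eps_step intro: eps_trans)

lemma step_imp_weak: "step p \<mu> q \<Longrightarrow> weak p \<mu> q"
  by (blast intro: weak_step_imp_weak weak_step_step)

lemma weak_eps: "eps p q \<Longrightarrow> weak q \<mu> r \<Longrightarrow> eps r s \<Longrightarrow> weak p \<mu> s"
  by (cases \<mu>) (auto intro: eps_trans weak_step_eps)

lemma WB_processD: "WB p q \<Longrightarrow> process p \<and> process q"
  using weak_bisimulation_WB unfolding weak_bisimulation_def by blast

lemma WB_sym: "WB p q \<Longrightarrow> WB q p"
  using weak_bisimulation_WB unfolding weak_bisimulation_def by (blast dest: sympD)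

lemma WB_step:
  assumes "WB p q" "step p \<mu> p'"
  obtains q' where "weak q \<mu> q'" "WB p' q'"
  using weak_bisimulation_WB assms unfolding weak_bisimulation_def by (metis eps_refl weak_Tau)

text \<open>The symmetric closure of \<open>R\<close>, joined with \<open>WB\<close>, is a weak
  bisimulation, so two one-sided transfer conditions suffice and an answer may leave
  \<open>R\<close> for pairs already known to be bisimilar. The clause for an unanswered silent step
  is absorbed by \<open>weak q Tau q\<close>.\<close>

lemma WB_coinduct:
  assumes "R p q" and proc: "\<And>p q. R p q \<Longrightarrow> process p \<and> process q"
    and sim: "\<And>p q \<mu> p'. R p q \<Longrightarrow> step p \<mu> p' \<Longrightarrow> \<exists>q'. weak q \<mu> q' \<and> (R p' q' \<or> WB p' q')"
    and simr: "\<And>p q \<mu> q'. R p q \<Longrightarrow> step q \<mu> q' \<Longrightarrow> \<exists>p'. weak p \<mu> p' \<and> (R p' q' \<or> WB p' q')"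
  shows "WB p q"
proof -
  let ?Q = "\<lambda>p q. R p q \<or> R q p \<or> WB p q"
  have "weak_bisimulation ?Q"
    unfolding weak_bisimulation_def
  proof (intro conjI allI impI sympI)
    fix p q :: "'a ccs" and \<mu> p'
    assume "?Q p q \<and> step p \<mu> p'"
    then have "\<exists>q'. weak q \<mu> q' \<and> ?Q p' q'"
      using sim simr by (metis WB_step WB_sym)
    then show "\<mu> = Tau \<and> ?Q p' q \<or> (\<exists>q'. weak q \<mu> q' \<and> ?Q p' q')" ..
  qed (use proc WB_processD in \<open>blast dest: WB_sym\<close>)+
  then show ?thesis using assms(1) WB_largest[of ?Q] by blast
qed

lemma WB_refl: "process p \<Longrightarrow> WB p p"
  by (rule WB_coinduct[where R = "\<lambda>p q. p = q \<and> process p"])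
    (auto intro: step_imp_weak process_step)

lemma WB_eps:
  assumes "eps p p'" "WB p q"
  obtains q' where "eps q q'" "WB p' q'"
proof -
  have "\<exists>q'. eps q q' \<and> WB p' q'" using assms
  proof (induction rule: eps_induct)
    case (step r s)
    then obtain q' where "eps q q'" "WB r q'" by blast
    with step(2) show ?case by (metis WB_step weak_Tau eps_trans)
  qed (blast intro: eps_refl)
  with that show ?thesis by blast
qed

lemma WB_weak_step:
  assumes "weak_step p \<mu> p'" "WB p q"
  obtains q' where "weak q \<mu> q'" "WB p' q'"
proof -
  obtain r s where *: "eps p r" "step r \<mu> s" "eps s p'"
    using assms(1) by (auto simp: weak_step_def)
  obtain r' where r': "eps q r'" "WB r r'" using WB_eps[OF *(1) assms(2)] .
  obtain s' where s': "weak r' \<mu> s'" "WB s s'" using WB_step[OF r'(2) *(2)] .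
  obtain t' where t': "eps s' t'" "WB p' t'" using WB_eps[OF *(3) s'(2)] .
  show ?thesis using that weak_eps[OF r'(1) s'(1) t'(1)] t'(2) .
qed

lemma WB_weak:
  assumes "weak p \<mu> p'" "WB p q"
  obtains q' where "weak q \<mu> q'" "WB p' q'"
  using assms by (cases \<mu>) (auto elim: WB_weak_step WB_eps)

lemma WB_trans:
  assumes "WB p q" "WB q r"
  shows "WB p r"
proof -
  let ?R = "\<lambda>p r. \<exists>q. WB p q \<and> WB q r"
  have sim: "\<exists>r'. weak r \<mu> r' \<and> ?R p' r'" if R: "?R p r" and p': "step p \<mu> p'" for p r p' :: "'a ccs" and \<mu>
  proof -
    obtain q where q: "WB p q" "WB q r" using R by blast
    obtain q' where q': "weak q \<mu> q'" "WB p' q'" using WB_step[OF q(1) p'] .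
    obtain r' where "weak r \<mu> r'" "WB q' r'" using WB_weak[OF q'(1) q(2)] .
    with q' show ?thesis by blast
  qed
  show ?thesis
  proof (rule WB_coinduct[where R = ?R])
    show "?R p r" using assms by blast
  next
    fix p r r' :: "'a ccs" and \<mu>
    assume R: "?R p r" and "step r \<mu> r'"
    from R have "?R r p" by (blast intro: WB_sym)
    from sim[OF this \<open>step r \<mu> r'\<close>] show "\<exists>p'. weak p \<mu> p' \<and> (?R p' r' \<or> WB p' r')"
      by (blast intro: WB_sym)
  qed (use sim WB_processD in blast)+
qed

section \<open>Parallel composition modulo weak bisimilarity\<close>

lemma eps_Par1: "eps p p' \<Longrightarrow> eps (Par p q) (Par p' q)"
  by (induction rule: eps_induct) (auto intro: eps_trans eps_step step.parL)

lemma eps_Par2: "eps q q' \<Longrightarrow> eps (Par p q) (Par p q')"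
  by (induction rule: eps_induct) (auto intro: eps_trans eps_step step.parR)

lemma eps_Par: "eps p p' \<Longrightarrow> eps q q' \<Longrightarrow> eps (Par p q) (Par p' q')"
  by (meson eps_Par1 eps_Par2 eps_trans)

lemma weak_step_Par1: "weak_step p \<mu> p' \<Longrightarrow> weak_step (Par p q) \<mu> (Par p' q)"
  unfolding weak_step_def by (meson eps_Par1 step.parL)

lemma weak_step_Par2: "weak_step q \<mu> q' \<Longrightarrow> weak_step (Par p q) \<mu> (Par p q')"
  unfolding weak_step_def by (meson eps_Par2 step.parR)

lemma weak_step_comm:
  "weak_step p (Vis \<alpha>) p' \<Longrightarrow> weak_step q (Vis (co \<alpha>)) q' \<Longrightarrow> weak_step (Par p q) Tau (Par p' q')"
  unfolding weak_step_def by (meson eps_Par step.comm)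

lemma weak_Par1: "weak p \<mu> p' \<Longrightarrow> weak (Par p q) \<mu> (Par p' q)"
  by (cases \<mu>) (auto intro: eps_Par1 weak_step_Par1)

lemma weak_Par2: "weak q \<mu> q' \<Longrightarrow> weak (Par p q) \<mu> (Par p q')"
  by (cases \<mu>) (auto intro: eps_Par2 weak_step_Par2)

inductive_cases step_ZeroE [elim!]: "step Zero \<mu> p"
inductive_cases step_VarE [elim!]: "step (Var x) \<mu> p"
inductive_cases step_PrefixE [elim!]: "step (Prefix \<nu> p) \<mu> q"
inductive_cases step_ChoiceE [elim!]: "step (Choice p q) \<mu> r"
inductive_cases step_ParE [elim]: "step (Par p q) \<mu> r"

lemma process_simps [simp]:
  "process Zero"
  "\<not> process (Var x)"
  "process (Prefix \<mu> p) \<longleftrightarrow> process p"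
  "process (Choice p q) \<longleftrightarrow> process p \<and> process q"
  "process (Par p q) \<longleftrightarrow> process p \<and> process q"
  by (auto simp: process_def)

definition par_WB :: "'a ccs \<Rightarrow> 'a ccs \<Rightarrow> bool" where
  "par_WB r r' \<longleftrightarrow> (\<exists>p q p' q'. r = Par p q \<and> r' = Par p' q' \<and> WB p p' \<and> WB q q')"

lemma par_WB_sym: "par_WB r r' \<Longrightarrow> par_WB r' r"
  unfolding par_WB_def by (blast intro: WB_sym)

lemma par_WB_sim:
  assumes "par_WB r r'" "step r \<mu> s"
  shows "\<exists>s'. weak r' \<mu> s' \<and> par_WB s s'"
proof -
  obtain p q p' q' where r: "r = Par p q" "r' = Par p' q'" and p: "WB p p'" and q: "WB q q'"
    using assms(1) by (auto simp: par_WB_def)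
  from assms(2)[unfolded r] show ?thesis
  proof cases
    case (parL p1)
    obtain p2 where "weak p' \<mu> p2" "WB p1 p2" using WB_step[OF p parL(2)] .
    with q show ?thesis unfolding r parL par_WB_def by (blast intro: weak_Par1)
  next
    case (parR q1)
    obtain q2 where "weak q' \<mu> q2" "WB q1 q2" using WB_step[OF q parR(2)] .
    with p show ?thesis unfolding r parR par_WB_def by (blast intro: weak_Par2)
  next
    case (comm \<alpha> p1 q1)
    obtain p2 where p2: "weak p' (Vis \<alpha>) p2" "WB p1 p2" using WB_step[OF p comm(3)] .
    obtain q2 where q2: "weak q' (Vis (co \<alpha>)) q2" "WB q1 q2" using WB_step[OF q comm(4)] .
    have "weak r' \<mu> (Par p2 q2)"
      using p2 q2 unfolding r comm by (auto intro: weak_step_imp_weak weak_step_comm simp del: weak_Tau)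
    with p2 q2 show ?thesis unfolding r comm par_WB_def by blast
  qed
qed

lemma WB_Par:
  assumes "WB p p'" "WB q q'"
  shows "WB (Par p q) (Par p' q')"
proof (rule WB_coinduct[where R = par_WB])
  show "par_WB (Par p q) (Par p' q')" using assms by (auto simp: par_WB_def)
next
  fix r r' s :: "'a ccs" and \<mu>
  assume R: "par_WB r r'"
  then show "process r \<and> process r'" by (auto simp: par_WB_def dest: WB_processD)
  show "\<exists>s'. weak r' \<mu> s' \<and> (par_WB s s' \<or> WB s s')" if "step r \<mu> s"
    using par_WB_sim[OF R that] by blast
  show "\<exists>s'. weak r \<mu> s' \<and> (par_WB s' s \<or> WB s' s)" if "step r' \<mu> s"
    using par_WB_sim[OF par_WB_sym[OF R] that] par_WB_sym by blast
qed

lemma WB_Par_Zero: "process p \<Longrightarrow> WB (Par Zero p) p"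
proof (rule WB_coinduct[where R = "\<lambda>r p. r = Par Zero p \<and> process p"])
  fix r p :: "'a ccs" and \<mu> r'
  assume "r = Par Zero p \<and> process p" "step r \<mu> r'"
  then show "\<exists>p'. weak p \<mu> p' \<and> ((r' = Par Zero p' \<and> process p') \<or> WB r' p')"
    by (auto intro: step_imp_weak process_step)
next
  fix r p :: "'a ccs" and \<mu> p'
  assume "r = Par Zero p \<and> process p" "step p \<mu> p'"
  then show "\<exists>r'. weak r \<mu> r' \<and> ((r' = Par Zero p' \<and> process p') \<or> WB r' p')"
    by (auto intro: step_imp_weak process_step step.parR)
qed auto

lemma WB_Par_Zero': "process p \<Longrightarrow> WB (Par p Zero) p"
proof (rule WB_coinduct[where R = "\<lambda>r p. r = Par p Zero \<and> process p"])
  fix r p :: "'a ccs" and \<mu> r'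
  assume "r = Par p Zero \<and> process p" "step r \<mu> r'"
  then show "\<exists>p'. weak p \<mu> p' \<and> ((r' = Par p' Zero \<and> process p') \<or> WB r' p')"
    by (auto intro: step_imp_weak process_step)
next
  fix r p :: "'a ccs" and \<mu> p'
  assume "r = Par p Zero \<and> process p" "step p \<mu> p'"
  then show "\<exists>r'. weak r \<mu> r' \<and> ((r' = Par p' Zero \<and> process p') \<or> WB r' p')"
    by (auto intro: step_imp_weak process_step step.parL)
qed auto

lemma WB_Par_null1: "WB p Zero \<Longrightarrow> process q \<Longrightarrow> WB (Par p q) q"
  by (meson WB_Par WB_Par_Zero WB_refl WB_trans)

lemma WB_Par_null2: "WB q Zero \<Longrightarrow> process p \<Longrightarrow> WB (Par p q) p"
  by (meson WB_Par WB_Par_Zero' WB_refl WB_trans)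

section \<open>Rooted weak bisimilarity as a congruence\<close>

lemma RWB_sym: "RWB p q \<Longrightarrow> RWB q p"
  unfolding RWB_def by (metis WB_sym)

lemma RWB_step:
  assumes "RWB p q" "step p \<mu> p'"
  obtains q' where "weak_step q \<mu> q'" "WB p' q'"
  using assms unfolding RWB_def by blast

lemma RWBI:
  assumes "process p" "process q"
    and "\<And>\<mu> p'. step p \<mu> p' \<Longrightarrow> \<exists>q'. weak_step q \<mu> q' \<and> WB p' q'"
    and "\<And>\<mu> q'. step q \<mu> q' \<Longrightarrow> \<exists>p'. weak_step p \<mu> p' \<and> WB p' q'"
  shows "RWB p q"
  using assms unfolding RWB_def by blast

lemma RWB_imp_WB:
  assumes "RWB p q"
  shows "WB p q"
proof (rule WB_coinduct[where R = RWB])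
  fix p q r :: "'a ccs" and \<mu>
  assume R: "RWB p q"
  then show "process p \<and> process q" by (simp add: RWB_def)
  show "\<exists>q'. weak q \<mu> q' \<and> (RWB r q' \<or> WB r q')" if "step p \<mu> r"
    using RWB_step[OF R that] weak_step_imp_weak by metis
  show "\<exists>p'. weak p \<mu> p' \<and> (RWB p' r \<or> WB p' r)" if "step q \<mu> r"
    using RWB_step[OF RWB_sym[OF R] that] weak_step_imp_weak WB_sym by metis
qed fact

lemma RWB_refl: "process p \<Longrightarrow> RWB p p"
  by (rule RWBI) (auto intro: weak_step_step WB_refl process_step)

text \<open>Rootedness concerns the first transition. If that is the \<open>\<mu>\<close> step
  itself, it is answered directly. Otherwise it is a silent step, whose answer contains a silent
  step; the remainder can then be matched by \<open>WB\<close>, and the whole answer is nonempty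
  even for \<open>\<mu> = Tau\<close>.\<close>

lemma RWB_weak_step:
  assumes "RWB p q" "weak_step p \<mu> p'"
  obtains q' where "weak_step q \<mu> q'" "WB p' q'"
proof -
  obtain r s where *: "eps p r" "step r \<mu> s" "eps s p'"
    using assms(2) by (auto simp: weak_step_def)
  show ?thesis
  proof (cases "r = p")
    case True
    with * obtain s' where "weak_step q \<mu> s'" "WB s s'" using RWB_step[OF assms(1)] by blast
    then show ?thesis using that WB_eps[OF *(3)] weak_step_eps by (metis eps_refl)
  next
    case False
    then obtain p1 where p1: "step p Tau p1" "eps p1 r"
      using *(1) unfolding eps_def by (metis converse_rtranclpE)
    obtain q1 where q1: "weak_step q Tau q1" "WB p1 q1" using RWB_step[OF assms(1) p1(1)] .
    have "weak_step p1 \<mu> p'" using p1(2) * by (auto simp: weak_step_def)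
    then obtain q' where q': "weak q1 \<mu> q'" "WB p' q'" using WB_weak_step q1(2) by blast
    have "eps q q1" using weak_step_imp_weak[OF q1(1)] by simp
    have "weak_step q \<mu> q'"
    proof (cases \<mu>)
      case Tau
      with q' q1 show ?thesis using weak_step_eps[OF eps_refl q1(1)] by simp
    next
      case (Vis \<alpha>)
      with q' \<open>eps q q1\<close> show ?thesis by (auto intro: weak_step_eps)
    qed
    with q' that show ?thesis by blast
  qed
qed

lemma RWB_trans:
  assumes "RWB p q" "RWB q r"
  shows "RWB p r"
proof -
  have sim: "\<exists>r'. weak_step r \<mu> r' \<and> WB p' r'"
    if pq: "RWB p q" and qr: "RWB q r" and p': "step p \<mu> p'" for p q r p' :: "'a ccs" and \<mu>
  proof -
    obtain q' where q': "weak_step q \<mu> q'" "WB p' q'" using RWB_step[OF pq p'] .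
    obtain r' where "weak_step r \<mu> r'" "WB q' r'" using RWB_weak_step[OF qr q'(1)] .
    with q' show ?thesis by (blast intro: WB_trans)
  qed
  show ?thesis
  proof (rule RWBI)
    show "process p" "process r" using assms by (auto simp: RWB_def)
    show "\<exists>r'. weak_step r \<mu> r' \<and> WB p' r'" if "step p \<mu> p'" for \<mu> p'
      using sim[OF assms that] .
    show "\<exists>p'. weak_step p \<mu> p' \<and> WB p' r'" if "step r \<mu> r'" for \<mu> r'
      using sim[OF RWB_sym[OF assms(2)] RWB_sym[OF assms(1)] that] by (blast intro: WB_sym)
  qed
qed

lemma WB_Prefix: "WB p q \<Longrightarrow> RWB (Prefix \<mu> p) (Prefix \<mu> q)"
  by (rule RWBI) (auto dest: WB_processD intro: weak_step_step step.prefix)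

text \<open>Only the first transition resolves a choice, so it is replayed from \<open>q\<close> and
  the rest of the sequence is kept.\<close>

lemma weak_step_Choice:
  assumes "weak_step p \<mu> p'" and *: "\<And>\<nu> r. step p \<nu> r \<Longrightarrow> step q \<nu> r"
  shows "weak_step q \<mu> p'"
proof -
  obtain r s where r: "eps p r" "step r \<mu> s" "eps s p'"
    using assms(1) by (auto simp: weak_step_def)
  from r(1) show ?thesis unfolding eps_def
  proof (cases rule: converse_rtranclpE)
    case base
    with r * show ?thesis unfolding weak_step_def by (meson eps_refl)
  next
    case (step p1)
    then have "eps q r" using * by (auto simp: eps_def intro: converse_rtranclp_into_rtranclp)
    with r show ?thesis by (auto simp: weak_step_def)
  qed
qed

lemma weak_step_Choice1: "weak_step p \<mu> p' \<Longrightarrow> weak_step (Choice p q) \<mu> p'"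
  by (erule weak_step_Choice) (rule step.choiceL)

lemma weak_step_Choice2: "weak_step p \<mu> p' \<Longrightarrow> weak_step (Choice q p) \<mu> p'"
  by (erule weak_step_Choice) (rule step.choiceR)

lemma RWB_Choice:
  assumes "RWB p p'" "RWB q q'"
  shows "RWB (Choice p q) (Choice p' q')"
proof (rule RWBI)
  show "process (Choice p q)" "process (Choice p' q')" using assms by (auto simp: RWB_def)
next
  fix \<mu> r
  assume "step (Choice p q) \<mu> r"
  then show "\<exists>r'. weak_step (Choice p' q') \<mu> r' \<and> WB r r'"
    by cases (use assms in \<open>metis RWB_step weak_step_Choice1 weak_step_Choice2\<close>)+
next
  fix \<mu> r'
  assume "step (Choice p' q') \<mu> r'"
  then show "\<exists>r. weak_step (Choice p q) \<mu> r \<and> WB r r'"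
    by cases (use assms in \<open>metis RWB_step RWB_sym WB_sym weak_step_Choice1 weak_step_Choice2\<close>)+
qed

lemma RWB_Par_sim:
  assumes "RWB p p'" "RWB q q'" "step (Par p q) \<mu> r"
  shows "\<exists>r'. weak_step (Par p' q') \<mu> r' \<and> WB r r'"
  using assms(3)
proof cases
  case (parL p1)
  with assms show ?thesis by (metis RWB_step weak_step_Par1 WB_Par RWB_imp_WB)
next
  case (parR q1)
  with assms show ?thesis by (metis RWB_step weak_step_Par2 WB_Par RWB_imp_WB)
next
  case (comm \<alpha> p1 q1)
  obtain p2 where "weak_step p' (Vis \<alpha>) p2" "WB p1 p2"
    using RWB_step[OF assms(1) comm(3)] .
  moreover obtain q2 where "weak_step q' (Vis (co \<alpha>)) q2" "WB q1 q2"
    using RWB_step[OF assms(2) comm(4)] .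
  ultimately show ?thesis using comm weak_step_comm WB_Par by blast
qed

lemma RWB_Par:
  assumes "RWB p p'" "RWB q q'"
  shows "RWB (Par p q) (Par p' q')"
proof (rule RWBI)
  show "process (Par p q)" "process (Par p' q')" using assms by (auto simp: RWB_def)
  show "\<exists>r'. weak_step (Par p' q') \<mu> r' \<and> WB r r'" if "step (Par p q) \<mu> r" for \<mu> r
    using RWB_Par_sim[OF assms that] .
  show "\<exists>r. weak_step (Par p q) \<mu> r \<and> WB r r'" if "step (Par p' q') \<mu> r'" for \<mu> r'
    using RWB_Par_sim[OF RWB_sym[OF assms(1)] RWB_sym[OF assms(2)] that] by (blast intro: WB_sym)
qed

section \<open>Substitution and soundness of equational logic\<close>

lemma process_subst: "\<forall>x\<in>vars t. process (\<sigma> x) \<Longrightarrow> process (subst \<sigma> t)"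
  by (induction t) auto

lemma subst_subst: "subst \<sigma> (subst \<rho> t) = subst (\<lambda>x. subst \<sigma> (\<rho> x)) t"
  by (induction t) auto

lemma subst_cong: "\<forall>x\<in>vars t. \<sigma> x = \<rho> x \<Longrightarrow> subst \<sigma> t = subst \<rho> t"
  by (induction t) auto

lemma subst_process: "process t \<Longrightarrow> subst \<sigma> t = t"
  by (induction t) auto

lemma sound_sym: "sound t u \<Longrightarrow> sound u t"
  unfolding sound_def by (blast intro: RWB_sym)

lemma derivable_sound:
  assumes "\<forall>(t, u) \<in> E. sound t u" "derivable E t u"
  shows "sound t u"
  using assms(2)
proof induction
  case (inst t u \<sigma>)
  then have "sound t u" using assms(1) by auto
  then show ?case unfolding sound_def subst_subst by (simp add: process_subst)
next
  case (refl t)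
  show ?case by (simp add: sound_def RWB_refl process_subst)
next
  case (sym t u)
  from sym.IH show ?case by (rule sound_sym)
next
  case (trans t u v)
  then show ?case unfolding sound_def by (blast intro: RWB_trans)
next
  case (prefix t u \<mu>)
  then show ?case unfolding sound_def by (simp add: WB_Prefix RWB_imp_WB)
next
  case (choice t u t' u')
  then show ?case unfolding sound_def by (simp add: RWB_Choice)
next
  case (par t u t' u')
  then show ?case unfolding sound_def by (simp add: RWB_Par)
qed

section \<open>Processes over a single visible label\<close>

text \<open>With the complement of \<open>l\<close> absent, no synchronisation is possible and
  parallel composition is pure interleaving.\<close>

fun only :: "'a label \<Rightarrow> 'a ccs \<Rightarrow> bool" where
  "only l Zero \<longleftrightarrow> True"
| "only l (Var x) \<longleftrightarrow> True"
| "only l (Prefix \<mu> p) \<longleftrightarrow> (\<mu> = Tau \<or> \<mu> = Vis l) \<and> only l p"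
| "only l (Choice p q) \<longleftrightarrow> only l p \<and> only l q"
| "only l (Par p q) \<longleftrightarrow> only l p \<and> only l q"

lemma co_neq [simp]: "co l \<noteq> l"
  by (cases l) auto

lemma only_step: "step p \<mu> q \<Longrightarrow> only l p \<Longrightarrow> only l q \<and> (\<mu> = Tau \<or> \<mu> = Vis l)"
  by (induction rule: step.induct) auto

lemma only_eps: "eps p q \<Longrightarrow> only l p \<Longrightarrow> only l q"
  by (induction rule: eps_induct) (auto dest: only_step)

lemma only_ParE [consumes 2, case_names left right]:
  assumes "step (Par p q) \<mu> r" "only l (Par p q)"
  obtains p' where "r = Par p' q" "step p \<mu> p'"
  | q' where "r = Par p q'" "step q \<mu> q'"
  using assms(1)
proof cases
  case (comm \<alpha> p' q')
  then have "\<alpha> = l" "co \<alpha> = l"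
    using assms(2) only_step by fastforce+
  then show ?thesis by simp
qed (use that in auto)

text \<open>Reachable visible labels are preserved by \<open>WB\<close>, whereas \<open>only\<close>
  is syntactic; this predicate serves to carry \<open>only\<close> across bisimilarity.\<close>

inductive can :: "'a ccs \<Rightarrow> 'a label \<Rightarrow> bool" where
  now: "step p (Vis m) p' \<Longrightarrow> can p m"
| later: "step p \<mu> p' \<Longrightarrow> can p' m \<Longrightarrow> can p m"

lemma can_Prefix: "can p m \<Longrightarrow> can (Prefix \<mu> p) m"
  by (blast intro: later step.prefix)

lemma can_Choice1: "can p m \<Longrightarrow> can (Choice p q) m"
  by (induction rule: can.induct) (blast intro: now later step.choiceL elim: can.cases)+

lemma can_Choice2: "can p m \<Longrightarrow> can (Choice q p) m"
  by (induction rule: can.induct) (blast intro: now later step.choiceR elim: can.cases)+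

lemma can_Par1: "can p m \<Longrightarrow> can (Par p q) m"
  by (induction rule: can.induct) (blast intro: now later step.parL)+

lemma can_Par2: "can p m \<Longrightarrow> can (Par q p) m"
  by (induction rule: can.induct) (blast intro: now later step.parR)+

lemma can_eps: "eps p q \<Longrightarrow> can q m \<Longrightarrow> can p m"
  by (induction rule: eps_induct) (auto intro: later)

lemma can_weak: "weak p \<mu> q \<Longrightarrow> can q m \<Longrightarrow> can p m"
  by (cases \<mu>) (use can_eps later in \<open>auto simp: weak_step_def, blast\<close>)

text \<open>In the absence of restriction no prefix is unreachable, hence each visible label written
  in \<open>p\<close> is eventually performed.\<close>

lemma only_iff: "only l p \<longleftrightarrow> (\<forall>m. can p m \<longrightarrow> m = l)"
proof
  assume "only l p"
  show "\<forall>m. can p m \<longrightarrow> m = l"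
  proof (intro allI impI)
    fix m
    assume "can p m"
    then show "m = l" using \<open>only l p\<close> by induction (auto dest: only_step)
  qed
next
  assume "\<forall>m. can p m \<longrightarrow> m = l"
  then show "only l p"
  proof (induction p)
    case (Prefix \<mu> p)
    then show ?case
      by (cases \<mu>) (auto intro: can_Prefix now step.prefix)
  qed (auto intro: can_Choice1 can_Choice2 can_Par1 can_Par2)
qed

lemma WB_can: "can p m \<Longrightarrow> WB p q \<Longrightarrow> can q m"
proof (induction arbitrary: q rule: can.induct)
  case (now p m p')
  obtain q' where "weak q (Vis m) q'" using WB_step[OF now(2,1)] .
  then show ?case by (auto simp: weak_step_def intro: can_eps can.now)
next
  case (later p \<mu> p' m)
  obtain q' where "weak q \<mu> q'" "WB p' q'" using WB_step[OF later(4,1)] .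
  then show ?case using later.IH can_weak by blast
qed

lemma WB_only: "WB p q \<Longrightarrow> only l p \<Longrightarrow> only l q"
  unfolding only_iff by (meson WB_can WB_sym)

text \<open>Run lengths are invariant under weak bisimilarity. The longest one is the depth; the
  existence of a short maximal run distinguishes \<open>\<sigma> x + a.a\<^sup>N\<close> from a process that has
  committed to \<open>a\<^sup>N\<close>.\<close>

inductive run :: "'a ccs \<Rightarrow> nat \<Rightarrow> bool" where
  stop: "\<forall>\<mu> q. \<not> step p \<mu> q \<Longrightarrow> run p 0"
| silent: "step p Tau q \<Longrightarrow> run q k \<Longrightarrow> run p k"
| visible: "step p (Vis m) q \<Longrightarrow> run q k \<Longrightarrow> run p (Suc k)"

fun sz :: "'a ccs \<Rightarrow> nat" where
  "sz Zero = 1"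
| "sz (Var x) = 1"
| "sz (Prefix \<mu> p) = Suc (sz p)"
| "sz (Choice p q) = Suc (sz p + sz q)"
| "sz (Par p q) = Suc (sz p + sz q)"

lemma sz_step: "step p \<mu> q \<Longrightarrow> sz q < sz p"
  by (induction rule: step.induct) auto

lemma run_eps: "eps p q \<Longrightarrow> run q k \<Longrightarrow> run p k"
  by (induction rule: eps_induct) (auto intro: silent)

text \<open>A silent derivative of \<open>q\<close> is again bisimilar to the stuck
  \<open>p\<close>, and a visible step of \<open>q\<close> would have no answer. Steps shrink
  \<open>sz\<close>, so following silent steps ends in a stuck process.\<close>

lemma run_WB_stuck: "\<forall>\<mu> q. \<not> step p \<mu> q \<Longrightarrow> WB p q \<Longrightarrow> run q 0"
proof (induction "sz q" arbitrary: q rule: less_induct)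
  case less
  show ?case
  proof (cases "\<exists>\<mu> q'. step q \<mu> q'")
    case True
    then obtain \<mu> q' where q': "step q \<mu> q'" by blast
    obtain p' where p': "weak p \<mu> p'" "WB q' p'" using WB_step[OF WB_sym[OF less(3)] q'] .
    have eps: "r = p" if "eps p r" for r using eps_stable[OF that] less(2) by blast
    have "\<mu> = Tau"
      using p'(1) less(2) by (cases \<mu>) (auto simp: weak_step_def dest!: eps)
    moreover have "p' = p" using p'(1) eps \<open>\<mu> = Tau\<close> by simp
    ultimately show ?thesis
      using less(1)[OF sz_step[OF q'] less(2)] p' q' by (auto intro: silent WB_sym)
  qed (auto intro: stop)
qed

lemma WB_run: "run p k \<Longrightarrow> WB p q \<Longrightarrow> run q k"
proof (induction arbitrary: q rule: run.induct)
  case (stop p)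
  then show ?case using run_WB_stuck by blast
next
  case (silent p p' k)
  obtain q' where "weak q Tau q'" "WB p' q'" using WB_step[OF silent(4,1)] .
  then show ?case using silent.IH run_eps by auto
next
  case (visible p m p' k)
  obtain q' where "weak_step q (Vis m) q'" "WB p' q'" using WB_step[OF visible(4,1)] by auto
  then show ?case using visible.IH
    unfolding weak_step_def by (blast intro: run_eps run.visible)
qed

text \<open>On processes satisfying \<open>only\<close>, \<open>run_depth\<close> and
  \<open>run_le_depth\<close> identify this with the largest number of visible steps in a run, which
  makes it invariant under \<open>WB\<close>.\<close>

fun depth :: "'a ccs \<Rightarrow> nat" where
  "depth Zero = 0"
| "depth (Var x) = 0"
| "depth (Prefix \<mu> p) = (if \<mu> = Tau then depth p else Suc (depth p))"
| "depth (Choice p q) = max (depth p) (depth q)"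
| "depth (Par p q) = depth p + depth q"

lemma depth_step:
  "step p \<mu> q \<Longrightarrow> only l p \<Longrightarrow> depth q + (if \<mu> = Tau then 0 else 1) \<le> depth p"
proof (induction rule: step.induct)
  case (comm p \<alpha> p' q q')
  then have "\<alpha> = l" "co \<alpha> = l" using only_step by fastforce+
  then show ?case by simp
qed auto

lemma depth_eps: "eps p q \<Longrightarrow> only l p \<Longrightarrow> depth q \<le> depth p"
  by (induction rule: eps_induct) (auto dest!: depth_step dest: only_eps)

lemma run_le_depth: "run p k \<Longrightarrow> only l p \<Longrightarrow> k \<le> depth p"
  by (induction rule: run.induct) (auto dest: depth_step only_step, (fastforce dest: depth_step only_step)+)

lemma depth_stuck: "\<forall>\<mu> q. \<not> step p \<mu> q \<Longrightarrow> depth p = 0"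
proof (induction p)
  case (Prefix \<mu> p)
  then show ?case by (blast intro: step.prefix)
next
  case (Choice p q)
  then show ?case by (auto intro: step.choiceL step.choiceR)
next
  case (Par p q)
  then show ?case by (auto intro: step.parL step.parR)
qed auto

lemma depth_attained:
  "step p \<mu> q \<Longrightarrow> \<exists>\<mu> q. step p \<mu> q \<and> depth p = depth q + (if \<mu> = Tau then 0 else 1)"
proof (induction p arbitrary: \<mu> q)
  case (Prefix \<nu> p)
  show ?case by (rule exI[of _ \<nu>], rule exI[of _ p]) (auto intro: step.prefix)
next
  case (Choice p1 p2)
  \<comment> \<open>If the deeper summand is stuck, both depths are 0 and the other summand, which
    moves, serves.\<close>
  consider "\<exists>\<mu> q. step p1 \<mu> q" "depth p2 \<le> depth p1" | "\<exists>\<mu> q. step p2 \<mu> q" "depth p1 \<le> depth p2"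
    using Choice.prems depth_stuck[of p1] depth_stuck[of p2] by (cases "depth p1 \<le> depth p2") force+
  then show ?case
  proof cases
    case 1
    then obtain \<nu> r where "step p1 \<nu> r" "depth p1 = depth r + (if \<nu> = Tau then 0 else 1)"
      using Choice.IH(1) by blast
    with 1 show ?thesis by (intro exI[of _ \<nu>] exI[of _ r]) (auto intro: step.choiceL)
  next
    case 2
    then obtain \<nu> r where "step p2 \<nu> r" "depth p2 = depth r + (if \<nu> = Tau then 0 else 1)"
      using Choice.IH(2) by blast
    with 2 show ?thesis by (intro exI[of _ \<nu>] exI[of _ r]) (auto intro: step.choiceR)
  qed
next
  case (Par p1 p2)
  consider "\<exists>\<mu> q. step p1 \<mu> q" | "\<exists>\<mu> q. step p2 \<mu> q"
    using Par.prems by blast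
  then show ?case
  proof cases
    case 1
    then obtain \<nu> r where "step p1 \<nu> r" "depth p1 = depth r + (if \<nu> = Tau then 0 else 1)"
      using Par.IH(1) by blast
    then show ?thesis by (intro exI[of _ \<nu>] exI[of _ "Par r p2"]) (auto intro: step.parL)
  next
    case 2
    then obtain \<nu> r where "step p2 \<nu> r" "depth p2 = depth r + (if \<nu> = Tau then 0 else 1)"
      using Par.IH(2) by blast
    then show ?thesis by (intro exI[of _ \<nu>] exI[of _ "Par p1 r"]) (auto intro: step.parR)
  qed
qed auto

lemma run_depth: "run p (depth p)"
proof (induction "sz p" arbitrary: p rule: less_induct)
  case less
  show ?case
  proof (cases "\<exists>\<mu> q. step p \<mu> q")
    case True
    then obtain \<mu> q where q: "step p \<mu> q" "depth p = depth q + (if \<mu> = Tau then 0 else 1)"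
      using depth_attained by blast
    with less[OF sz_step[OF q(1)]] show ?thesis
      by (cases \<mu>) (auto intro: silent visible)
  next
    case False
    then show ?thesis using depth_stuck[of p] by (auto intro: stop)
  qed
qed

lemma WB_depth: "WB p q \<Longrightarrow> only l p \<Longrightarrow> depth p = depth q"
  by (meson WB_only WB_run WB_sym le_antisym run_depth run_le_depth)

text \<open>Depth 0 leaves only silent steps, which keep the depth at 0; \<open>Zero\<close> answers
  each by staying put.\<close>

lemma WB_Zero:
  assumes "only l p" "process p" "depth p = 0"
  shows "WB p Zero"
proof (rule WB_coinduct[where R = "\<lambda>p q. q = Zero \<and> only l p \<and> process p \<and> depth p = 0"])
  fix p q p' :: "'a ccs" and \<mu>
  assume p: "q = Zero \<and> only l p \<and> process p \<and> depth p = 0"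
  then show "process p \<and> process q" by simp
  show "\<exists>q'. weak q \<mu> q' \<and> ((q' = Zero \<and> only l p' \<and> process p' \<and> depth p' = 0) \<or> WB p' q')"
    if "step p \<mu> p'"
    using p that depth_step[OF that, of l] only_step[OF that, of l] process_step[OF that]
    by (auto intro!: exI[of _ Zero] split: if_splits)
  show "\<exists>p''. weak p \<mu> p'' \<and> ((p' = Zero \<and> only l p'' \<and> process p'' \<and> depth p'' = 0) \<or> WB p'' p')"
    if "step q \<mu> p'"
    using p that by auto
qed (use assms in auto)

lemma WB_Zero_depth: "WB p Zero \<Longrightarrow> depth p = 0"
  using WB_depth[OF WB_sym, of p Zero] by simp

text \<open>Since the components never synchronise, a maximal run splits into one maximal run of
  each.\<close>

lemma run_Par: "run r k \<Longrightarrow> r = Par p q \<Longrightarrow> only l r \<Longrightarrow> \<exists>i j. run p i \<and> run q j \<and> k = i + j"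
proof (induction arbitrary: p q rule: run.induct)
  case (stop r)
  then have "run p 0" "run q 0" by (auto intro!: run.stop intro: step.parL step.parR)
  then show ?case by force
next
  case (silent r r' k)
  then have "only l r'" by (blast dest: only_step)
  from silent have "step (Par p q) Tau r'" "only l (Par p q)" by simp_all
  then show ?case
  proof (cases rule: only_ParE)
    case (left p')
    with silent.IH[OF left(1) \<open>only l r'\<close>] show ?thesis by (blast intro: run.silent)
  next
    case (right q')
    with silent.IH[OF right(1) \<open>only l r'\<close>] show ?thesis by (blast intro: run.silent)
  qed
next
  case (visible r m r' k)
  then have "only l r'" by (blast dest: only_step)
  from visible have "step (Par p q) (Vis m) r'" "only l (Par p q)" by simp_all
  then show ?case
  proof (cases rule: only_ParE)
    case (left p')
    then obtain i j where "run p' i" "run q j" "k = i + j"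
      using visible.IH[OF left(1) \<open>only l r'\<close>] by blast
    with left have "run p (Suc i)" "run q j" "Suc k = Suc i + j" by (auto intro: run.visible)
    then show ?thesis by blast
  next
    case (right q')
    then obtain i j where "run p i" "run q' j" "k = i + j"
      using visible.IH[OF right(1) \<open>only l r'\<close>] by blast
    with right have "run p i" "run q (Suc j)" "Suc k = i + Suc j" by (auto intro: run.visible)
    then show ?thesis by blast
  qed
qed

section \<open>Powers of the label\<close>

fun pw :: "'a label \<Rightarrow> nat \<Rightarrow> 'a ccs" where
  "pw l 0 = Zero"
| "pw l (Suc n) = Prefix (Vis l) (pw l n)"

lemma pw_simps [simp]: "process (pw l n)" "only l (pw l n)" "depth (pw l n) = n"
  by (induction n) auto

lemma step_pw: "step (pw l n) \<mu> q \<longleftrightarrow> \<mu> = Vis l \<and> (\<exists>m. n = Suc m \<and> q = pw l m)"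
  by (cases n) (auto intro: step.prefix)

lemma run_pw: "run (pw l n) k \<Longrightarrow> k = n"
  by (induction "pw l n" k arbitrary: n rule: run.induct) (auto simp: step_pw gr0_conv_Suc, metis not0_implies_Suc)

section \<open>Exposed variables\<close>

text \<open>The sum of the depths of the parallel partners of an unguarded occurrence of \<open>x\<close> is \<open>k\<close>.\<close>

inductive expo :: "(nat \<Rightarrow> 'a ccs) \<Rightarrow> nat \<Rightarrow> nat \<Rightarrow> 'a ccs \<Rightarrow> bool" for \<sigma> x where
  var: "expo \<sigma> x 0 (Var x)"
| choiceL: "expo \<sigma> x k t \<Longrightarrow> expo \<sigma> x k (Choice t u)"
| choiceR: "expo \<sigma> x k t \<Longrightarrow> expo \<sigma> x k (Choice u t)"
| parL: "expo \<sigma> x k t \<Longrightarrow> expo \<sigma> x (k + depth (subst \<sigma> u)) (Par t u)"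
| parR: "expo \<sigma> x k t \<Longrightarrow> expo \<sigma> x (k + depth (subst \<sigma> u)) (Par u t)"

lemma expo_vars: "expo \<sigma> x k t \<Longrightarrow> x \<in> vars t"
  by (induction rule: expo.induct) auto

lemma depth_subst_var: "x \<in> vars t \<Longrightarrow> depth (\<sigma> x) \<le> depth (subst \<sigma> t)"
  by (induction t) auto

lemma only_subst_var: "x \<in> vars t \<Longrightarrow> only l (subst \<sigma> t) \<Longrightarrow> only l (\<sigma> x)"
  by (induction t) auto

text \<open>Describes the effect of adding the summand \<open>w\<close> to copies of
  \<open>s\<close>. A relation is used because derivatives of the two instances need not be
  instances of one term any more; \<open>refl\<close> covers the parts in which nothing was
  added.\<close>

inductive ext :: "'a ccs \<Rightarrow> 'a ccs \<Rightarrow> 'a ccs \<Rightarrow> 'a ccs \<Rightarrow> bool" for s w where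
  refl: "ext s w p p"
| here: "ext s w s (Choice s w)"
| prefix: "ext s w p p' \<Longrightarrow> ext s w (Prefix \<mu> p) (Prefix \<mu> p')"
| choice: "ext s w p p' \<Longrightarrow> ext s w q q' \<Longrightarrow> ext s w (Choice p q) (Choice p' q')"
| par: "ext s w p p' \<Longrightarrow> ext s w q q' \<Longrightarrow> ext s w (Par p q) (Par p' q')"

lemma ext_subst: "ext (\<sigma> x) w (subst \<sigma> t) (subst (\<sigma>(x := Choice (\<sigma> x) w)) t)"
  by (induction t) (auto intro: ext.intros)

lemma ext_only: "ext s w p p' \<Longrightarrow> only l w \<Longrightarrow> only l p \<Longrightarrow> only l p'"
  by (induction rule: ext.induct) auto

lemma ext_step: "ext s w p p' \<Longrightarrow> step p \<mu> q \<Longrightarrow> \<exists>q'. step p' \<mu> q' \<and> ext s w q q'"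
proof (induction arbitrary: \<mu> q rule: ext.induct)
  case (refl p)
  then show ?case by (blast intro: ext.refl)
next
  case here
  then show ?case by (blast intro: ext.refl step.choiceL)
next
  case (prefix p p' \<nu>)
  then show ?case by (blast intro: step.prefix)
next
  case (choice p p' q q')
  then show ?case by (blast intro: step.choiceL step.choiceR)
next
  case (par p p' q q')
  from par.prems show ?case
  proof cases
    case (parL p1)
    with par show ?thesis by (blast intro: step.parL ext.par)
  next
    case (parR q1)
    with par show ?thesis by (blast intro: step.parR ext.par)
  next
    case (comm \<alpha> p1 q1)
    with par show ?thesis by (blast intro: step.comm ext.par)
  qed
qed

text \<open>As \<open>s\<close> can already move, adding an alternative to it never makes a stuck
  process active. Hence \<open>ext_run\<close> can keep maximal runs maximal.\<close>

lemma ext_stuck: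
  assumes "ext s w p p'" "step s \<nu> s'" "step p' \<mu> q'"
  shows "\<exists>\<mu> q. step p \<mu> q"
  using assms(1,3)
proof (induction arbitrary: \<mu> q' rule: ext.induct)
  case (par p p' q q')
  from par.prems show ?case
    by cases (use par.IH in \<open>blast intro: step.parL step.parR\<close>)+
qed (use assms(2) in \<open>blast intro: step.intros\<close>)+

lemma ext_run: "run p k \<Longrightarrow> ext s w p p' \<Longrightarrow> step s \<nu> s' \<Longrightarrow> run p' k"
proof (induction arbitrary: p' rule: run.induct)
  case (stop p)
  then have "\<forall>\<mu> q. \<not> step p' \<mu> q" using ext_stuck[OF stop(2,3)] by metis
  then show ?case by (rule run.stop)
next
  case (silent p q k)
  obtain q' where "step p' Tau q'" "ext s w q q'" using ext_step[OF silent(4,1)] by blast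
  then show ?case using silent.IH silent.prems(2) run.silent by metis
next
  case (visible p m q k)
  obtain q' where "step p' (Vis m) q'" "ext s w q q'" using ext_step[OF visible(4,1)] by blast
  then show ?case using visible.IH visible.prems(2) run.visible by metis
qed

text \<open>The added summand offers only the visible \<open>l\<close>, and \<open>only l\<close>
  excludes synchronisation with it, so no silent step of \<open>p'\<close> is new.\<close>

lemma ext_Tau:
  assumes "ext s (Prefix (Vis l) w) p p'" "only l p'" "step p' Tau q'"
  shows "\<exists>q. step p Tau q \<and> ext s (Prefix (Vis l) w) q q'"
  using assms
proof (induction arbitrary: q' rule: ext.induct)
  case (refl p)
  then show ?case using ext.refl by metis
next
  case here
  then have "step s Tau q'" by auto
  then show ?case using ext.refl by metis
next
  case (prefix p p' \<nu>)
  then have "\<nu> = Tau" "q' = p'" by auto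
  then show ?case using prefix(1) step.prefix by metis
next
  case (choice p p' q r)
  then consider "step p' Tau q'" | "step r Tau q'" by auto
  then show ?case
  proof cases
    case 1
    with choice show ?thesis using step.choiceL[of p] by (metis only.simps(4))
  next
    case 2
    with choice show ?thesis using step.choiceR[of q] by (metis only.simps(4))
  qed
next
  case (par p p' q r)
  from par.prems(2,1) show ?case
  proof (cases rule: only_ParE)
    case (left p1)
    with par.IH(1) par.prems obtain p2 where "step p Tau p2" "ext s (Prefix (Vis l) w) p2 p1"
      by auto
    with left par.hyps(2) show ?thesis by (auto intro!: exI step.parL ext.par)
  next
    case (right r1)
    with par.IH(2) par.prems obtain r2 where "step q Tau r2" "ext s (Prefix (Vis l) w) r2 r1"
      by auto
    with right par.hyps(1) show ?thesis by (auto intro!: exI step.parR ext.par)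
  qed
qed

lemma ext_eps:
  assumes "eps p' q'" "ext s (Prefix (Vis l) w) p p'" "only l p'"
  shows "\<exists>q. eps p q \<and> ext s (Prefix (Vis l) w) q q'"
  using assms
proof (induction rule: eps_induct)
  case (step r r')
  then obtain q where q: "eps p q" "ext s (Prefix (Vis l) w) q r" by blast
  moreover obtain q' where "step q Tau q'" "ext s (Prefix (Vis l) w) q' r'"
    using ext_Tau[OF q(2) only_eps[OF step(1,5)] step(2)] by blast
  ultimately show ?case by (blast intro: eps_trans eps_step)
qed (blast intro: eps_refl)

text \<open>The exposed \<open>x\<close> takes the new summand and becomes \<open>pw l N\<close>,
  while its partners of total depth \<open>k\<close> stay put. Every maximal run then contains all
  of \<open>pw l N\<close>, hence the lower bound. The condition
  \<open>k < depth (\<sigma> x)\<close> keeps \<open>x\<close> out of the partners, so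
  \<open>\<rho>\<close> leaves them unchanged.\<close>

lemma expo_step:
  fixes \<sigma> l N x
  defines "\<rho> \<equiv> \<sigma>(x := Choice (\<sigma> x) (pw l (Suc N)))"
  assumes "expo \<sigma> x k t" "k < depth (\<sigma> x)" "only l (subst \<rho> t)"
  shows "\<exists>r. step (subst \<rho> t) (Vis l) r \<and> depth r = N + k \<and> (\<forall>j. run r j \<longrightarrow> N \<le> j)"
  using assms(2-)
proof (induction rule: expo.induct)
  case var
  have "step (Choice (\<sigma> x) (pw l (Suc N))) (Vis l) (pw l N)"
    by (auto intro: step.intros)
  then show ?case using run_pw by (intro exI[of _ "pw l N"]) (auto simp: \<rho>_def)
next
  case (parL k t u)
  obtain r where r: "step (subst \<rho> t) (Vis l) r" "depth r = N + k" "\<And>j. run r j \<Longrightarrow> N \<le> j"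
    using parL by auto
  have "x \<notin> vars u" using parL.prems(1) depth_subst_var[of x u \<sigma>] by auto
  then have u: "subst \<rho> u = subst \<sigma> u" by (auto simp: \<rho>_def intro: subst_cong)
  have "only l r" using only_step[OF r(1)] parL.prems by auto
  moreover have "only l (subst \<sigma> u)" using parL.prems u by auto
  ultimately have "only l (Par r (subst \<sigma> u))" by simp
  then have "N \<le> j" if "run (Par r (subst \<sigma> u)) j" for j
    using run_Par[OF that HOL.refl] r(3) by fastforce
  then show ?case using r u
    by (intro exI[of _ "Par r (subst \<sigma> u)"]) (auto intro: step.parL)
next
  case (parR k t u)
  obtain r where r: "step (subst \<rho> t) (Vis l) r" "depth r = N + k" "\<And>j. run r j \<Longrightarrow> N \<le> j"
    using parR by auto
  have "x \<notin> vars u" using parR.prems(1) depth_subst_var[of x u \<sigma>] by auto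
  then have u: "subst \<rho> u = subst \<sigma> u" by (auto simp: \<rho>_def intro: subst_cong)
  have "only l r" using only_step[OF r(1)] parR.prems by auto
  moreover have "only l (subst \<sigma> u)" using parR.prems u by auto
  ultimately have "only l (Par (subst \<sigma> u) r)" by simp
  then have "N \<le> j" if "run (Par (subst \<sigma> u) r) j" for j
    using run_Par[OF that HOL.refl] r(3) by fastforce
  then show ?case using r u
    by (intro exI[of _ "Par (subst \<sigma> u) r"]) (auto intro: step.parR)
qed (auto intro: step.choiceL step.choiceR)

lemma stable_Par:
  assumes "only l (Par p q)" "\<forall>r. \<not> step p Tau r" "\<forall>r. \<not> step q Tau r"
  shows "\<forall>r. \<not> step (Par p q) Tau r"
  using assms by (blast elim: only_ParE[rotated])

text \<open>A step of the extended instance is either inherited from \<open>subst \<sigma> u\<close>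
  or picks the new summand at an exposed \<open>x\<close>; in the latter case \<open>k\<close> is
  the total depth of the partners under \<open>\<rho>\<close>. The derivative is then stable if the
  source is, because \<open>pw l N\<close> is stable.\<close>

lemma step_subst_cases:
  fixes \<sigma> l N x
  defines "w \<equiv> pw l (Suc N)"
  defines "\<rho> \<equiv> \<sigma>(x := Choice (\<sigma> x) w)"
  assumes "only l (subst \<rho> u)" "step (subst \<rho> u) \<mu> r"
  shows "(\<exists>q. step (subst \<sigma> u) \<mu> q \<and> ext (\<sigma> x) w q r) \<or>
    (\<mu> = Vis l \<and> (\<exists>k. depth r = N + k \<and> (k < N \<longrightarrow> expo \<sigma> x k u)) \<and>
     ((\<forall>s. \<not> step (subst \<rho> u) Tau s) \<longrightarrow> (\<forall>s. \<not> step r Tau s)))"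
  using assms(3,4)
proof (induction u arbitrary: \<mu> r)
  case (Var y)
  then show ?case
    by (auto simp: w_def \<rho>_def step_pw split: if_splits intro: ext.refl expo.var)
next
  case (Prefix \<nu> u)
  then have "\<mu> = \<nu>" "r = subst \<rho> u" by auto
  then show ?case using ext_subst[of \<sigma> x w u] unfolding \<rho>_def by (auto intro!: exI step.prefix)
next
  case (Choice u1 u2)
  from Choice.prems(2) have "step (subst \<rho> u1) \<mu> r \<or> step (subst \<rho> u2) \<mu> r" by auto
  then show ?case
  proof
    assume "step (subst \<rho> u1) \<mu> r"
    from Choice.IH(1)[OF _ this] Choice.prems(1) show ?thesis
      by (auto intro: step.choiceL expo.choiceL)
  next
    assume "step (subst \<rho> u2) \<mu> r"
    from Choice.IH(2)[OF _ this] Choice.prems(1) show ?thesis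
      by (auto intro: step.choiceR expo.choiceR)
  qed
next
  case (Par u1 u2)
  \<comment> \<open>An occurrence of \<open>x\<close> would give the partner a depth above
    \<open>N\<close>. A shallower partner thus has the same instance under \<open>\<sigma>\<close>
    and \<open>\<rho>\<close>, so that its depth is the one counted by
    \<open>expo \<sigma>\<close>.\<close>
  have same: "subst \<rho> v = subst \<sigma> v" if "depth (subst \<rho> v) < N" for v
  proof (rule subst_cong, rule ballI)
    fix y assume "y \<in> vars v"
    then have "y \<noteq> x" using depth_subst_var[of x v \<rho>] that by (auto simp: \<rho>_def w_def)
    then show "\<rho> y = \<sigma> y" by (simp add: \<rho>_def)
  qed
  have e: "ext (\<sigma> x) w (subst \<sigma> v) (subst \<rho> v)" for v
    unfolding \<rho>_def by (rule ext_subst)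
  from Par.prems have "step (Par (subst \<rho> u1) (subst \<rho> u2)) \<mu> r"
    "only l (Par (subst \<rho> u1) (subst \<rho> u2))" by simp_all
  then show ?case
  proof (cases rule: only_ParE)
    case (left p)
    then have only: "only l (Par p (subst \<rho> u2))" using Par.prems by (auto dest: only_step)
    from left(2) Par.IH(1) Par.prems(1) consider
      (a) q where "step (subst \<sigma> u1) \<mu> q" "ext (\<sigma> x) w q p"
    | (b) k where "\<mu> = Vis l" "depth p = N + k" "k < N \<longrightarrow> expo \<sigma> x k u1"
        "(\<forall>s. \<not> step (subst \<rho> u1) Tau s) \<longrightarrow> (\<forall>s. \<not> step p Tau s)"
      by force
    then show ?thesis
    proof cases
      case a
      then show ?thesis using left e by (auto intro: step.parL ext.par)
    next
      case b
      have "k + depth (subst \<rho> u2) < N \<longrightarrow> expo \<sigma> x (k + depth (subst \<rho> u2)) (Par u1 u2)"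
        using b(3) same[of u2] by (auto intro: expo.parL)
      moreover have "\<forall>s. \<not> step r Tau s" if "\<forall>s. \<not> step (subst \<rho> (Par u1 u2)) Tau s"
        unfolding left by (rule stable_Par[OF only]) (use that b(4) in \<open>auto intro: step.parL step.parR\<close>)
      ultimately show ?thesis using b left by fastforce
    qed
  next
    case (right p)
    then have only: "only l (Par (subst \<rho> u1) p)" using Par.prems by (auto dest: only_step)
    from right(2) Par.IH(2) Par.prems(1) consider
      (a) q where "step (subst \<sigma> u2) \<mu> q" "ext (\<sigma> x) w q p"
    | (b) k where "\<mu> = Vis l" "depth p = N + k" "k < N \<longrightarrow> expo \<sigma> x k u2"
        "(\<forall>s. \<not> step (subst \<rho> u2) Tau s) \<longrightarrow> (\<forall>s. \<not> step p Tau s)"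
      by force
    then show ?thesis
    proof cases
      case a
      then show ?thesis using right e by (auto intro: step.parR ext.par)
    next
      case b
      have "k + depth (subst \<rho> u1) < N \<longrightarrow> expo \<sigma> x (k + depth (subst \<rho> u1)) (Par u1 u2)"
        using b(3) same[of u1] by (auto intro: expo.parR)
      moreover have "\<forall>s. \<not> step r Tau s" if "\<forall>s. \<not> step (subst \<rho> (Par u1 u2)) Tau s"
        unfolding right by (rule stable_Par[OF only]) (use that b(4) in \<open>auto intro: step.parL step.parR\<close>)
      ultimately show ?thesis using b right by (fastforce simp: add.commute add.left_commute)
    qed
  qed
qed auto

text \<open>Adding \<open>pw l (Suc N)\<close> to \<open>\<sigma> x\<close> lets the instance of
  \<open>t\<close> step to a process of depth \<open>N + k\<close> all of whose maximal runs have
  length at least \<open>N\<close>. The instance of \<open>u\<close> can answer only by the new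
  summand at an exposed \<open>x\<close>, and the depth of the answer reveals the depth of the
  partners there.\<close>

lemma expo_sound:
  assumes "sound t u" "\<forall>x. process (\<sigma> x)" "only l (subst \<sigma> t)"
    and stable: "\<forall>q. \<not> step (subst \<sigma> t) Tau q"
    and "expo \<sigma> x k t" "k < depth (\<sigma> x)"
  shows "expo \<sigma> x k u"
proof -
  \<comment> \<open>Larger than \<open>depth (subst \<sigma> u)\<close>, to exclude inherited
    answers, and larger than \<open>k\<close>, to meet the condition \<open>k < N\<close> in
    \<open>step_subst_cases\<close>.\<close>
  define N where "N = Suc (k + depth (subst \<sigma> u))"
  define w where "w = pw l (Suc N)"
  define \<rho> where "\<rho> = \<sigma>(x := Choice (\<sigma> x) w)"
  have w: "w = Prefix (Vis l) (pw l N)" by (simp add: w_def)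
  have e: "ext (\<sigma> x) w (subst \<sigma> v) (subst \<rho> v)" for v
    unfolding \<rho>_def by (rule ext_subst)
  have "\<forall>x. process (\<rho> x)" using assms(2) by (simp add: \<rho>_def w_def)
  then have RWB: "RWB (subst \<rho> t) (subst \<rho> u)" and "RWB (subst \<sigma> t) (subst \<sigma> u)"
    using assms(1,2) by (auto simp: sound_def)
  then have only_u: "only l (subst \<sigma> u)" using WB_only[OF RWB_imp_WB] assms(3) by blast
  have only_w: "only l w" by (simp only: w_def pw_simps)
  have only: "only l (subst \<rho> t)" "only l (subst \<rho> u)"
    using ext_only[OF e only_w] assms(3) only_u by blast+
  have "\<forall>q. \<not> step (subst \<rho> t) Tau q"
    using ext_Tau[OF e[unfolded w] only(1)] stable by blast
  then have stable_u: "\<forall>q. \<not> step (subst \<rho> u) Tau q"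
    using RWB_step[OF RWB_sym[OF RWB]] weak_step_stable by metis
  obtain r where r: "step (subst \<rho> t) (Vis l) r" "depth r = N + k" "\<And>j. run r j \<Longrightarrow> N \<le> j"
    using expo_step[OF assms(5,6), of l N] only(1) unfolding \<rho>_def w_def by blast
  have "only l r" using only_step[OF r(1) only(1)] by blast
  obtain r1 r2 where r2: "step (subst \<rho> u) (Vis l) r1" "eps r1 r2" "WB r r2"
    using RWB_step[OF RWB r(1)] weak_step_stable[OF _ stable_u] by metis
  have only_r1: "only l r1" using only_step[OF r2(1) only(2)] by blast
  have depth_r2: "depth r2 = N + k" using WB_depth[OF r2(3) \<open>only l r\<close>] r(2) by simp
  from step_subst_cases[OF only(2)[unfolded \<rho>_def w_def] r2(1)[unfolded \<rho>_def w_def]]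
  show ?thesis
  proof (elim disjE exE conjE)
    \<comment> \<open>An inherited answer keeps a maximal run of at most
      \<open>depth (subst \<sigma> u)\<close> visible steps. This is less than \<open>N\<close> and
      contradicts the bound on the runs of \<open>r\<close>.\<close>
    fix q
    assume q: "step (subst \<sigma> u) (Vis l) q" "ext (\<sigma> x) (pw l (Suc N)) q r1"
    have only_q: "only l q" using only_step[OF q(1) only_u] by blast
    obtain q2 where q2: "eps q q2" "ext (\<sigma> x) w q2 r2"
      using ext_eps[OF r2(2) q(2)[folded w_def, unfolded w] only_r1] unfolding w by blast
    have "depth q2 \<le> depth (subst \<sigma> u)"
      using depth_step[OF q(1) only_u] depth_eps[OF q2(1) only_q] by simp
    moreover obtain \<nu> s where "step (\<sigma> x) \<nu> s"
      using depth_stuck[of "\<sigma> x"] assms(6) by auto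
    then have "run r2 (depth q2)" using ext_run[OF run_depth q2(2)] by blast
    then have "N \<le> depth q2" using WB_run WB_sym[OF r2(3)] r(3) by blast
    ultimately show ?thesis by (simp add: N_def)
  next
    fix k'
    assume k': "depth r1 = N + k'" "k' < N \<longrightarrow> expo \<sigma> x k' u"
      and "(\<forall>s. \<not> step (subst (\<sigma>(x := Choice (\<sigma> x) (pw l (Suc N)))) u) Tau s) \<longrightarrow> (\<forall>s. \<not> step r1 Tau s)"
    \<comment> \<open>Stability identifies \<open>r2\<close> with \<open>r1\<close>, so comparing
      depths yields \<open>k' = k\<close>.\<close>
    then have "\<forall>s. \<not> step r1 Tau s" using stable_u unfolding \<rho>_def w_def by blast
    then have "r2 = r1" using eps_stable[OF r2(2)] by blast
    then have "k' = k" "k' < N" using depth_r2 k'(1) by (auto simp: N_def)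
    then show ?thesis using k'(2) by blast
  qed
qed

section \<open>The equations and their separating invariant\<close>

fun phi :: "'a label \<Rightarrow> nat \<Rightarrow> 'a ccs" where
  "phi l 0 = Zero"
| "phi l (Suc n) = Choice (phi l n) (pw l (Suc n))"

fun tails :: "'a label \<Rightarrow> nat \<Rightarrow> 'a ccs" where
  "tails l 0 = Zero"
| "tails l (Suc n) = Choice (tails l n) (pw l (Suc (Suc n)))"

lemma phi_simps [simp]: "process (phi l n)" "only l (phi l n)" "depth (phi l n) = n"
  by (induction n) auto

lemma tails_process [simp]: "process (tails l n)"
  by (induction n) auto

lemma step_Choice_iff: "step (Choice p q) \<mu> r \<longleftrightarrow> step p \<mu> r \<or> step q \<mu> r"
  by (auto intro: step.choiceL step.choiceR)

lemma step_phi: "step (phi l n) \<mu> q \<longleftrightarrow> \<mu> = Vis l \<and> (\<exists>i<n. q = pw l i)"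
  by (induction n) (auto simp: step_Choice_iff step_pw less_Suc_eq intro: step.prefix)

lemma step_tails: "step (tails l n) \<mu> q \<longleftrightarrow> \<mu> = Vis l \<and> (\<exists>i<n. q = pw l (Suc i))"
  by (induction n) (auto simp: step_Choice_iff step_pw less_Suc_eq simp del: pw.simps)

lemma WB_pw_depth: "WB p (pw l i) \<Longrightarrow> depth p = i"
  using WB_depth[where l = l and p = "pw l i" and q = p] WB_sym by force

lemma WB_pw: "WB p (pw l i) \<Longrightarrow> WB p (pw l j) \<Longrightarrow> i = j"
  using WB_pw_depth by metis

lemma WB_pw_Suc: "WB (Par (pw l 1) (pw l i)) (pw l (Suc i))"
proof (induction i)
  case 0
  show ?case by (simp add: WB_Par_Zero')
next
  case (Suc i)
  let ?R = "\<lambda>p q. p = Par (pw l 1) (pw l (Suc i)) \<and> q = pw l (Suc (Suc i))"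
  have z: "WB (Par Zero (pw l (Suc i))) (pw l (Suc i))" by (rule WB_Par_Zero) (rule pw_simps)
  have s: "step (pw l (Suc n)) (Vis l) (pw l n)" for n by (simp only: step_pw) simp
  show ?case
  proof (rule WB_coinduct[where R = ?R])
    fix p q r :: "'a ccs" and \<mu>
    assume R: "?R p q"
    show "process p \<and> process q" using R by simp
    show "\<exists>q'. weak q \<mu> q' \<and> (?R r q' \<or> WB r q')" if "step p \<mu> r"
    proof -
      from that R have "step (Par (pw l 1) (pw l (Suc i))) \<mu> r" by blast
      then have "\<mu> = Vis l \<and> (r = Par Zero (pw l (Suc i)) \<or> r = Par (pw l 1) (pw l i))"
        by (rule only_ParE[where l = l]) (auto simp: step_pw simp del: pw.simps, auto)
      then show ?thesis using R z Suc s step_imp_weak by blast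
    qed
    show "\<exists>p'. weak p \<mu> p' \<and> (?R p' r \<or> WB p' r)" if "step q \<mu> r"
    proof -
      from that R have "\<mu> = Vis l" "r = pw l (Suc i)" by (auto simp: step_pw simp del: pw.simps)
      then show ?thesis using R Suc step_imp_weak[OF step.parR[OF s]] by blast
    qed
  qed blast
qed

text \<open>The prefix summand accounts for the step of the left component. \<open>tails\<close>
  accounts for the steps of \<open>phi l n\<close>, whose results
  \<open>Par (pw l 1) (pw l i)\<close> are bisimilar to \<open>pw l (Suc i)\<close>.\<close>

lemma phi_law:
  "RWB (Par (pw l 1) (phi l n)) (Choice (Prefix (Vis l) (phi l n)) (tails l n))"
proof (rule RWBI)
  fix \<mu> p
  assume "step (Par (pw l 1) (phi l n)) \<mu> p"
  then have "\<mu> = Vis l \<and> (p = Par Zero (phi l n) \<or> (\<exists>i<n. p = Par (pw l 1) (pw l i)))"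
    by (rule only_ParE[where l = l]) (auto simp: step_phi)
  then show "\<exists>q. weak_step (Choice (Prefix (Vis l) (phi l n)) (tails l n)) \<mu> q \<and> WB p q"
  proof (elim conjE disjE exE)
    assume "\<mu> = Vis l" "p = Par Zero (phi l n)"
    then show ?thesis
      by (intro exI[of _ "phi l n"]) (auto simp: WB_Par_Zero intro: weak_step_step step.intros)
  next
    fix i assume "\<mu> = Vis l" "i < n" "p = Par (pw l 1) (pw l i)"
    then show ?thesis
      using WB_pw_Suc[of l i] step.choiceR[of "tails l n" \<mu> "pw l (Suc i)"] weak_step_step
      unfolding step_tails by metis
  qed
next
  fix \<mu> q
  assume "step (Choice (Prefix (Vis l) (phi l n)) (tails l n)) \<mu> q"
  then have "\<mu> = Vis l \<and> (q = phi l n \<or> (\<exists>i<n. q = pw l (Suc i)))"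
    by (auto simp: step_tails simp del: pw.simps)
  then show "\<exists>p. weak_step (Par (pw l 1) (phi l n)) \<mu> p \<and> WB p q"
  proof (elim conjE disjE exE)
    assume "\<mu> = Vis l" "q = phi l n"
    then show ?thesis
      by (intro exI[of _ "Par Zero (phi l n)"])
        (auto simp: WB_Par_Zero intro: weak_step_step step.intros)
  next
    fix i assume i: "\<mu> = Vis l" "i < n" "q = pw l (Suc i)"
    then have "step (Par (pw l 1) (phi l n)) (Vis l) (Par (pw l 1) (pw l i))"
      by (intro step.parR) (auto simp: step_phi)
    with i show ?thesis using WB_pw_Suc weak_step_step by metis
  qed
qed auto

section \<open>The invariant and its side condition\<close>

definition derivs :: "'a label \<Rightarrow> 'a ccs set \<Rightarrow> 'a ccs \<Rightarrow> bool" where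
  "derivs l S p \<longleftrightarrow> only l p \<and> process p \<and> (\<forall>\<mu> q. step p \<mu> q \<longrightarrow> \<mu> = Vis l \<and> (\<exists>s\<in>S. WB q s))"

abbreviation powers :: "'a label \<Rightarrow> 'a ccs \<Rightarrow> bool" where
  "powers l \<equiv> derivs l (range (pw l))"

text \<open>The side condition under which the invariant is preserved. It is closed under
  \<open>RWB\<close> and passes to summands and to the partner of a null component, as the induction
  on derivations requires.\<close>

abbreviation summands :: "'a label \<Rightarrow> nat \<Rightarrow> 'a ccs \<Rightarrow> bool" where
  "summands l n \<equiv> derivs l (insert (phi l n) (range (pw l)))"

text \<open>The last two disjuncts of the \<open>Par\<close> clause look through components
  bisimilar to \<open>Zero\<close>; they make the invariant respect sound equations such as the one
  between \<open>x\<close> and \<open>Par x Zero\<close>.\<close>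

fun par_summand :: "'a label \<Rightarrow> nat \<Rightarrow> 'a ccs \<Rightarrow> bool" where
  "par_summand l n (Choice p q) \<longleftrightarrow> par_summand l n p \<or> par_summand l n q"
| "par_summand l n (Par p q) \<longleftrightarrow>
     WB p (pw l 1) \<and> WB q (phi l n) \<or> WB p (phi l n) \<and> WB q (pw l 1) \<or>
     WB p Zero \<and> par_summand l n q \<or> par_summand l n p \<and> WB q Zero"
| "par_summand l n _ \<longleftrightarrow> False"

definition forks :: "'a label \<Rightarrow> 'a ccs \<Rightarrow> bool" where
  "forks l p \<longleftrightarrow> (\<exists>i j q r. i \<noteq> j \<and> step p (Vis l) q \<and> WB q (pw l i) \<and> step p (Vis l) r \<and> WB r (pw l j))"

lemma derivs_stable: "derivs l S p \<Longrightarrow> \<forall>q. \<not> step p Tau q"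
  unfolding derivs_def by blast

lemma derivs_Choice: "derivs l S (Choice p q) \<longleftrightarrow> derivs l S p \<and> derivs l S q"
  unfolding derivs_def step_Choice_iff by auto

lemma derivs_Par1:
  assumes "derivs l S (Par p q)" "WB p Zero"
  shows "derivs l S q"
  unfolding derivs_def
proof (intro conjI allI impI)
  show "only l q" "process q" using assms by (auto simp: derivs_def)
next
  fix \<mu> r
  assume r: "step q \<mu> r"
  then have "\<mu> = Vis l" and *: "\<exists>s\<in>S. WB (Par p r) s"
    using assms(1) step.parR[OF r] unfolding derivs_def by blast+
  show "\<mu> = Vis l" by fact
  have "WB (Par p r) r"
    using assms r process_step[OF r] by (auto simp: derivs_def intro: WB_Par_null1)
  with * show "\<exists>s\<in>S. WB r s" by (meson WB_sym WB_trans)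
qed

lemma derivs_Par2:
  assumes "derivs l S (Par p q)" "WB q Zero"
  shows "derivs l S p"
  unfolding derivs_def
proof (intro conjI allI impI)
  show "only l p" "process p" using assms by (auto simp: derivs_def)
next
  fix \<mu> r
  assume r: "step p \<mu> r"
  then have "\<mu> = Vis l" and *: "\<exists>s\<in>S. WB (Par r q) s"
    using assms(1) step.parL[OF r] unfolding derivs_def by blast+
  show "\<mu> = Vis l" by fact
  have "WB (Par r q) r"
    using assms r process_step[OF r] by (auto simp: derivs_def intro: WB_Par_null2)
  with * show "\<exists>s\<in>S. WB r s" by (meson WB_sym WB_trans)
qed

text \<open>The processes \<open>phi l n\<close> and \<open>pw l i\<close> are stable, so silent
  steps of a derivative bisimilar to one of them stay in its class. The absence of initial silent
  steps passes to \<open>q\<close> because rootedness asks for a nonempty answer.\<close>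

lemma summands_RWB:
  assumes "RWB p q" "summands l n p"
  shows "summands l n q"
  unfolding derivs_def
proof (intro conjI allI impI)
  show "only l q" using WB_only[OF RWB_imp_WB[OF assms(1)]] assms(2) by (simp add: derivs_def)
  show "process q" using assms(1) by (simp add: RWB_def)
next
  fix \<mu> q'
  assume q': "step q \<mu> q'"
  obtain p' where p': "weak_step p \<mu> p'" "WB q' p'" using RWB_step[OF RWB_sym[OF assms(1)] q'] .
  obtain r where r: "step p \<mu> r" "eps r p'"
    using weak_step_stable[OF p'(1) derivs_stable[OF assms(2)]] .
  show "\<mu> = Vis l" using r(1) assms(2) by (auto simp: derivs_def)
  obtain s where s: "s \<in> insert (phi l n) (range (pw l))" "WB r s"
    using r(1) assms(2) unfolding derivs_def by blast
  have "\<forall>s'. \<not> step s Tau s'" using s(1) by (auto simp: step_phi step_pw)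
  then have "WB p' s" using WB_eps[OF r(2) s(2)] eps_stable by metis
  then have "WB q' s" by (rule WB_trans[OF p'(2)])
  with s(1) show "\<exists>s\<in>insert (phi l n) (range (pw l)). WB q' s" by blast
qed

text \<open>An \<open>l\<close> step of \<open>p\<close> is answered by the unique step of
  \<open>pw l k\<close>, so derivatives bisimilar to powers share one exponent.\<close>

lemma forks_not_pw:
  assumes "forks l p" "\<forall>q. \<not> step p Tau q" "WB p (pw l k)"
  shows False
proof -
  have "k = Suc i" if q: "step p (Vis l) q" "WB q (pw l i)" for q i
  proof -
    obtain r where r: "weak_step (pw l k) (Vis l) r" "WB q r"
      using WB_step[OF assms(3) q(1)] by auto
    obtain s where s: "step (pw l k) (Vis l) s" "eps s r"
      using weak_step_stable[OF r(1)] by (auto simp: step_pw)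
    then obtain m where m: "k = Suc m" "s = pw l m" by (auto simp: step_pw)
    then have "r = pw l m" using eps_stable[OF s(2)] by (auto simp: step_pw)
    then have "i = m" using WB_pw[OF q(2)] r(2) by blast
    with m show ?thesis by simp
  qed
  with assms(1) show False unfolding forks_def by blast
qed

lemma forks_depth:
  assumes "forks l p" "only l p"
  shows "1 < depth p"
proof -
  obtain i j q r where *: "i \<noteq> j" "step p (Vis l) q" "WB q (pw l i)" "step p (Vis l) r" "WB r (pw l j)"
    using assms(1) by (auto simp: forks_def)
  have "depth q = i" "depth r = j"
    using * WB_pw_depth by blast+
  then show ?thesis using *(1) depth_step[OF *(2) assms(2)] depth_step[OF *(4) assms(2)] by auto
qed

lemma par_summand_depth: "par_summand l n p \<Longrightarrow> only l p \<Longrightarrow> 0 < depth p"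
  by (induction p) (auto dest: WB_depth simp del: pw.simps)

lemma depth_1:
  assumes "only l p" "process p" "\<forall>q. \<not> step p Tau q" "depth p = 1"
  shows "WB p (pw l 1)"
proof (rule RWB_imp_WB, rule RWBI)
  have Z: "WB q Zero" if q: "step p (Vis l) q" for q
    using depth_step[OF q assms(1)] only_step[OF q assms(1)] process_step[OF q assms(2)] assms(4)
    by (intro WB_Zero) auto
  show "\<exists>q'. weak_step (pw l 1) \<mu> q' \<and> WB p' q'" if p': "step p \<mu> p'" for \<mu> p'
  proof -
    have "\<mu> = Vis l" using only_step[OF p' assms(1)] assms(3) p' by blast
    with Z p' show ?thesis by (auto intro: weak_step_step step.prefix)
  qed
  obtain \<mu> q where q: "step p \<mu> q" using depth_stuck[of p] assms(4) by auto
  then have "\<mu> = Vis l" using only_step[OF q assms(1)] assms(3) by blast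
  with q Z show "\<exists>p'. weak_step p \<mu> p' \<and> WB p' q'" if "step (pw l 1) \<mu> q'" for \<mu> q'
    using that by (auto simp: step_pw intro: weak_step_step)
qed (use assms in auto)

section \<open>Counting the exponents of derivatives\<close>

definition exponents :: "'a label \<Rightarrow> 'a ccs \<Rightarrow> nat set" where
  "exponents l p = {i. \<exists>q. step p (Vis l) q \<and> WB q (pw l i)}"

text \<open>A null component has depth 0, hence no \<open>l\<close> step. Each \<open>l\<close>
  derivative therefore comes from \<open>q\<close>, and dropping the null component keeps it
  bisimilar.\<close>

lemma exponents_Par_null1:
  assumes "WB p Zero" "only l (Par p q)" "process q"
  shows "exponents l (Par p q) \<subseteq> exponents l q"
proof
  fix i assume "i \<in> exponents l (Par p q)"
  then obtain r where r: "step (Par p q) (Vis l) r" "WB r (pw l i)" by (auto simp: exponents_def)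
  from r(1) assms(2) show "i \<in> exponents l q"
  proof (cases rule: only_ParE)
    case (left p')
    then show ?thesis
      using depth_step[OF left(2), of l] assms(2) WB_Zero_depth[OF assms(1)] by simp
  next
    case (right q')
    have "WB (Par p q') q'"
      using WB_Par_null1[OF assms(1)] process_step[OF right(2) assms(3)] .
    then have "WB q' (pw l i)" using r(2) right(1) WB_trans WB_sym by blast
    with right show ?thesis by (auto simp: exponents_def)
  qed
qed

lemma exponents_Par_null2:
  assumes "WB q Zero" "only l (Par p q)" "process p"
  shows "exponents l (Par p q) \<subseteq> exponents l p"
proof
  fix i assume "i \<in> exponents l (Par p q)"
  then obtain r where r: "step (Par p q) (Vis l) r" "WB r (pw l i)" by (auto simp: exponents_def)
  from r(1) assms(2) show "i \<in> exponents l p"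
  proof (cases rule: only_ParE)
    case (left p')
    have "WB (Par p' q) p'"
      using WB_Par_null2[OF assms(1)] process_step[OF left(2) assms(3)] .
    then have "WB p' (pw l i)" using r(2) left(1) WB_trans WB_sym by blast
    with left show ?thesis by (auto simp: exponents_def)
  next
    case (right q')
    then show ?thesis
      using depth_step[OF right(2), of l] assms(2) WB_Zero_depth[OF assms(1)] by simp
  qed
qed

lemma pw_weak_step:
  assumes "WB r (pw l i)" "step r (Vis l) s"
  shows "\<exists>m. i = Suc m \<and> WB s (pw l m)"
proof -
  obtain t where t: "weak_step (pw l i) (Vis l) t" "WB s t"
    using WB_step[OF assms] by auto
  obtain u where u: "step (pw l i) (Vis l) u" "eps u t"
    using weak_step_stable[OF t(1)] by (auto simp: step_pw)
  then obtain m where m: "i = Suc m" "u = pw l m" by (auto simp: step_pw)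
  then have "t = pw l m" using eps_stable[OF u(2)] by (auto simp: step_pw)
  with t m show ?thesis by blast
qed

lemma not_null_step:
  assumes "only l p" "process p" "\<forall>q. \<not> step p Tau q" "\<not> WB p Zero"
  obtains q where "step p (Vis l) q"
proof -
  have "depth p \<noteq> 0" using assms(4) WB_Zero[OF assms(1,2)] by auto
  then obtain \<mu> q where q: "step p \<mu> q" using depth_stuck[of p] by auto
  then have "\<mu> = Vis l" using only_step[OF q assms(1)] assms(3) by blast
  with q that show ?thesis by blast
qed

text \<open>If both components can move, the steps of either one commute with those of the other, so
  all derivatives have the same exponent.\<close>

lemma exponents_Par:
  assumes pq: "powers l (Par p q)" and nz: "\<not> WB p Zero" "\<not> WB q Zero"
  shows "\<exists>i. exponents l (Par p q) \<subseteq> {i}"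
proof -
  have only: "only l (Par p q)" "only l p" "only l q" "process p" "process q"
    using pq by (auto simp: derivs_def)
  have der: "\<mu> = Vis l" "\<exists>i. WB r (pw l i)" if "step (Par p q) \<mu> r" for \<mu> r
    using pq that by (auto simp: derivs_def)
  have stable: "\<forall>r. \<not> step p Tau r" "\<forall>r. \<not> step q Tau r"
    using der(1)[OF step.parL] der(1)[OF step.parR] by blast+
  obtain p0 where p0: "step p (Vis l) p0"
    using not_null_step[OF only(2,4) stable(1) nz(1)] .
  obtain q0 where q0: "step q (Vis l) q0"
    using not_null_step[OF only(3,5) stable(2) nz(2)] .
  obtain m where m: "WB (Par p0 q) (pw l m)"
    using der(2)[OF step.parL[OF p0]] by blast
  have q: "i = m" if q1: "step q (Vis l) q1" and i: "WB (Par p q1) (pw l i)" for q1 i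
  proof -
    obtain a where "i = Suc a" "WB (Par p0 q1) (pw l a)"
      using pw_weak_step[OF i step.parL[OF p0]] by blast
    moreover obtain b where "m = Suc b" "WB (Par p0 q1) (pw l b)"
      using pw_weak_step[OF m step.parR[OF q1]] by blast
    ultimately show ?thesis using WB_pw by blast
  qed
  obtain m' where m': "WB (Par p q0) (pw l m')"
    using der(2)[OF step.parR[OF q0]] by blast
  \<comment> \<open>Derivatives of \<open>p\<close> are compared through \<open>q0\<close>. The
    exponent \<open>m'\<close> belongs to a derivative of \<open>q\<close>, so the first half
    identifies it with \<open>m\<close>.\<close>
  have p: "i = m" if p1: "step p (Vis l) p1" and i: "WB (Par p1 q) (pw l i)" for p1 i
  proof -
    obtain a where "i = Suc a" "WB (Par p1 q0) (pw l a)"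
      using pw_weak_step[OF i step.parR[OF q0]] by blast
    moreover obtain b where "m' = Suc b" "WB (Par p1 q0) (pw l b)"
      using pw_weak_step[OF m' step.parL[OF p1]] by blast
    moreover have "m' = m" using q[OF q0 m'] .
    ultimately show ?thesis using WB_pw by blast
  qed
  have "i = m" if i: "i \<in> exponents l (Par p q)" for i
  proof -
    obtain r where r: "step (Par p q) (Vis l) r" "WB r (pw l i)"
      using i by (auto simp: exponents_def)
    from r(1) only(1) show ?thesis
    proof (cases rule: only_ParE)
      case (left p')
      with r(2) show ?thesis by (auto intro: p)
    next
      case (right q')
      with r(2) show ?thesis by (auto intro: q)
    qed
  qed
  then show ?thesis by blast
qed

lemma card_subset_singleton: "A \<subseteq> {i :: nat} \<Longrightarrow> finite A \<and> card A \<le> 1"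
  using card_mono[of "{i}" A] finite_subset[of A "{i}"] by simp

lemma card_subset_le: "A \<subseteq> B \<Longrightarrow> finite B \<and> card B \<le> k \<Longrightarrow> k \<le> k' \<Longrightarrow> finite A \<and> card A \<le> k'"
  by (meson card_mono finite_subset le_trans)

lemma expo_Par_null1:
  assumes "WB (subst \<sigma> t) Zero" "expo \<sigma> x k u"
  shows "expo \<sigma> x k (Par t u)"
  using expo.parR[OF assms(2), of t] WB_Zero_depth[OF assms(1)] by simp

lemma expo_Par_null2:
  assumes "WB (subst \<sigma> t) Zero" "expo \<sigma> x k u"
  shows "expo \<sigma> x k (Par u t)"
  using expo.parL[OF assms(2), of t] WB_Zero_depth[OF assms(1)] by simp

lemma few_exponents:
  assumes "powers l (subst \<sigma> t)" "\<forall>x. expo \<sigma> x 0 t \<longrightarrow> \<not> forks l (\<sigma> x)"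
  shows "finite (exponents l (subst \<sigma> t)) \<and> card (exponents l (subst \<sigma> t)) \<le> sz t"
  using assms
proof (induction t)
  case Zero
  have "exponents l Zero = {}" by (auto simp: exponents_def)
  then show ?case by simp
next
  case (Var x)
  then have "\<not> forks l (\<sigma> x)" by (auto intro: expo.var)
  then obtain i where "exponents l (\<sigma> x) \<subseteq> {i}" unfolding forks_def exponents_def by blast
  from card_subset_singleton[OF this] show ?case by simp
next
  case (Prefix \<mu> t)
  have "exponents l (Prefix \<mu> (subst \<sigma> t)) \<subseteq> {depth (subst \<sigma> t)}"
    by (auto simp: exponents_def WB_pw_depth)
  from card_subset_singleton[OF this] show ?case by simp
next
  case (Choice t u)
  have "powers l (subst \<sigma> t)" "powers l (subst \<sigma> u)"
    using Choice.prems(1) by (auto simp: derivs_def step_Choice_iff)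
  moreover have "\<forall>x. expo \<sigma> x 0 t \<longrightarrow> \<not> forks l (\<sigma> x)" "\<forall>x. expo \<sigma> x 0 u \<longrightarrow> \<not> forks l (\<sigma> x)"
    using Choice.prems(2) expo.choiceL[of \<sigma> _ 0 t u] expo.choiceR[of \<sigma> _ 0 u t] by blast+
  ultimately have "finite (exponents l (subst \<sigma> t)) \<and> card (exponents l (subst \<sigma> t)) \<le> sz t"
    "finite (exponents l (subst \<sigma> u)) \<and> card (exponents l (subst \<sigma> u)) \<le> sz u"
    using Choice.IH by simp_all
  moreover have "exponents l (subst \<sigma> (Choice t u)) = exponents l (subst \<sigma> t) \<union> exponents l (subst \<sigma> u)"
    by (auto simp: exponents_def step_Choice_iff)
  ultimately show ?case
    using card_Un_le[of "exponents l (subst \<sigma> t)" "exponents l (subst \<sigma> u)"] by simp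
next
  case (Par t u)
  have P: "powers l (Par (subst \<sigma> t) (subst \<sigma> u))" using Par.prems(1) by simp
  then have only: "only l (Par (subst \<sigma> t) (subst \<sigma> u))" "process (subst \<sigma> t)" "process (subst \<sigma> u)"
    by (auto simp: derivs_def)
  consider "WB (subst \<sigma> t) Zero" | "WB (subst \<sigma> u) Zero"
    | "\<not> WB (subst \<sigma> t) Zero" "\<not> WB (subst \<sigma> u) Zero" by blast
  then show ?case
  proof cases
    case 1
    have "\<forall>x. expo \<sigma> x 0 u \<longrightarrow> \<not> forks l (\<sigma> x)" using Par.prems(2) expo_Par_null1[OF 1] by blast
    from card_subset_le[OF exponents_Par_null1[OF 1 only(1,3)]
        Par.IH(2)[OF derivs_Par1[OF P 1] this], of "sz (Par t u)"]
    show ?thesis by simp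
  next
    case 2
    have "\<forall>x. expo \<sigma> x 0 t \<longrightarrow> \<not> forks l (\<sigma> x)" using Par.prems(2) expo_Par_null2[OF 2] by blast
    from card_subset_le[OF exponents_Par_null2[OF 2 only(1,2)]
        Par.IH(1)[OF derivs_Par2[OF P 2] this], of "sz (Par t u)"]
    show ?thesis by simp
  next
    case 3
    then obtain i where "exponents l (Par (subst \<sigma> t) (subst \<sigma> u)) \<subseteq> {i}"
      using exponents_Par[OF P] by blast
    from card_subset_singleton[OF this] show ?thesis by simp
  qed
qed

lemma WB_phi_powers:
  assumes "WB p (phi l n)" "\<forall>q. \<not> step p Tau q"
  shows "powers l p"
  unfolding derivs_def
proof (intro conjI allI impI)
  show only: "only l p" using WB_only[OF WB_sym[OF assms(1)]] by simp
  show "process p" using WB_processD[OF assms(1)] by simp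
  fix \<mu> q
  assume q: "step p \<mu> q"
  show \<mu>: "\<mu> = Vis l" using only_step[OF q only] q assms(2) by blast
  obtain r where r: "weak_step (phi l n) (Vis l) r" "WB q r"
    using WB_step[OF assms(1) q] \<mu> by auto
  obtain s where s: "step (phi l n) (Vis l) s" "eps s r"
    using weak_step_stable[OF r(1)] by (auto simp: step_phi)
  then obtain i where i: "s = pw l i" by (auto simp: step_phi)
  then have "r = pw l i" using eps_stable[OF s(2)] by (auto simp: step_pw)
  with r show "\<exists>s\<in>range (pw l). WB q s" by blast
qed

text \<open>The answer to a step of \<open>phi l n\<close> is a step of \<open>p\<close> followed by
  silent ones. By \<open>WB_phi_powers\<close> that step already leads to a power, so the silent
  steps do not change the exponent.\<close>

lemma WB_phi_exponents:
  assumes "WB p (phi l n)" "\<forall>q. \<not> step p Tau q"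
  shows "{..<n} \<subseteq> exponents l p"
proof
  fix i assume "i \<in> {..<n}"
  then have i: "step (phi l n) (Vis l) (pw l i)" by (auto simp: step_phi)
  obtain r where r: "weak_step p (Vis l) r" "WB (pw l i) r"
    using WB_step[OF WB_sym[OF assms(1)] i] by auto
  obtain s where s: "step p (Vis l) s" "eps s r" using weak_step_stable[OF r(1) assms(2)] .
  obtain j where j: "WB s (pw l j)"
    using WB_phi_powers[OF assms] s(1) by (auto simp: derivs_def)
  have "WB r (pw l j)" using WB_eps[OF s(2) j] eps_stable by (metis step_pw action.distinct(1))
  then have "i = j" using WB_pw[of r] WB_sym[OF r(2)] by blast
  with j s show "i \<in> exponents l p" by (auto simp: exponents_def)
qed

text \<open>Pigeonhole: all \<open>n\<close> exponents below \<open>n\<close> occur, too many for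
  \<open>few_exponents\<close>.\<close>

lemma exposed_fork:
  assumes "WB (subst \<sigma> t) (phi l n)" "\<forall>q. \<not> step (subst \<sigma> t) Tau q" "sz t < n"
  shows "\<exists>x. expo \<sigma> x 0 t \<and> forks l (\<sigma> x)"
proof (rule ccontr)
  assume "\<not> ?thesis"
  then have "finite (exponents l (subst \<sigma> t)) \<and> card (exponents l (subst \<sigma> t)) \<le> sz t"
    using few_exponents[OF WB_phi_powers[OF assms(1,2)]] by blast
  then have "card {..<n} \<le> sz t"
    using card_mono[OF _ WB_phi_exponents[OF assms(1,2)]] by linarith
  with assms(3) show False by simp
qed

text \<open>If a \<open>Par\<close> of \<open>t\<close> itself splits into \<open>pw l 1\<close> and
  \<open>phi l n\<close>, then \<open>exposed_fork\<close> finds a forking variable in the component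
  for \<open>phi l n\<close>; the other component, of depth 1, accounts for the index 1.\<close>

lemma par_summand_subst:
  assumes "par_summand l n (subst \<sigma> t)" "summands l n (subst \<sigma> t)" "sz t < n"
  shows "\<exists>x. expo \<sigma> x 0 t \<and> par_summand l n (\<sigma> x) \<or> expo \<sigma> x 1 t \<and> forks l (\<sigma> x)"
  using assms
proof (induction t)
  case (Var x)
  then show ?case by (auto intro: expo.var)
next
  case (Choice t u)
  then have "summands l n (subst \<sigma> t)" "summands l n (subst \<sigma> u)" by (simp_all add: derivs_Choice)
  with Choice show ?case by (auto intro: expo.choiceL expo.choiceR; blast intro: expo.choiceL expo.choiceR)
next
  case (Par t u)
  have P: "summands l n (Par (subst \<sigma> t) (subst \<sigma> u))" using Par.prems(2) by simp
  have stable: "\<forall>q. \<not> step (subst \<sigma> t) Tau q" "\<forall>q. \<not> step (subst \<sigma> u) Tau q"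
    using derivs_stable[OF P] by (blast intro: step.parL step.parR)+
  note depth = WB_pw_depth[of _ l 1]
  have sz: "sz t < n" "sz u < n" using Par.prems(3) by auto
  from Par.prems(1) consider
    (a) "WB (subst \<sigma> t) (pw l 1)" "WB (subst \<sigma> u) (phi l n)"
  | (b) "WB (subst \<sigma> t) (phi l n)" "WB (subst \<sigma> u) (pw l 1)"
  | (c) "WB (subst \<sigma> t) Zero" "par_summand l n (subst \<sigma> u)"
  | (d) "par_summand l n (subst \<sigma> t)" "WB (subst \<sigma> u) Zero"
    by (simp del: pw.simps) blast
  then show ?case
  proof cases
    case a
    obtain x where "expo \<sigma> x 0 u" "forks l (\<sigma> x)" using exposed_fork[OF a(2) stable(2) sz(2)] by blast
    then show ?thesis using expo.parR[of \<sigma> x 0 u t] depth[OF a(1)] by auto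
  next
    case b
    obtain x where "expo \<sigma> x 0 t" "forks l (\<sigma> x)" using exposed_fork[OF b(1) stable(1) sz(1)] by blast
    then show ?thesis using expo.parL[of \<sigma> x 0 t u] depth[OF b(2)] by auto
  next
    case c
    from Par.IH(2)[OF c(2) derivs_Par1[OF P c(1)] sz(2)] show ?thesis
      using expo_Par_null1[OF c(1)] by blast
  next
    case d
    from Par.IH(1)[OF d(1) derivs_Par2[OF P d(2)] sz(1)] show ?thesis
      using expo_Par_null2[OF d(2)] by blast
  qed
qed auto

section \<open>From exposed variables back to parallel summands\<close>

lemma expo_par_summand:
  assumes "expo \<sigma> x k t" "k = 0" "par_summand l n (\<sigma> x)" "only l (subst \<sigma> t)" "process (subst \<sigma> t)"
  shows "par_summand l n (subst \<sigma> t)"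
  using assms by (induction rule: expo.induct) (auto intro: WB_Zero)

text \<open>Partners of total depth 0 are bisimilar to \<open>Zero\<close>, so both derivatives of
  \<open>\<sigma> x\<close> keep their exponents.\<close>

lemma expo_forks:
  assumes "expo \<sigma> x k t" "k = 0" "forks l (\<sigma> x)" "only l (subst \<sigma> t)" "process (subst \<sigma> t)"
  shows "forks l (subst \<sigma> t)"
  using assms
proof (induction rule: expo.induct)
  case (parL k t u)
  then have Z: "WB (subst \<sigma> u) Zero" by (auto intro: WB_Zero)
  have "step (Par p (subst \<sigma> u)) (Vis l) (Par q (subst \<sigma> u)) \<and> WB (Par q (subst \<sigma> u)) (pw l i)"
    if "step p (Vis l) q" "WB q (pw l i)" for p q i
    using that WB_Par_null2[OF Z] WB_processD[OF that(2)] by (blast intro: step.parL WB_trans)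
  moreover have "forks l (subst \<sigma> t)" using parL by simp
  ultimately show ?case unfolding forks_def subst.simps by meson
next
  case (parR k t u)
  then have Z: "WB (subst \<sigma> u) Zero" by (auto intro: WB_Zero)
  have "step (Par (subst \<sigma> u) p) (Vis l) (Par (subst \<sigma> u) q) \<and> WB (Par (subst \<sigma> u) q) (pw l i)"
    if "step p (Vis l) q" "WB q (pw l i)" for p q i
    using that WB_Par_null1[OF Z] WB_processD[OF that(2)] by (blast intro: step.parR WB_trans)
  moreover have "forks l (subst \<sigma> t)" using parR by simp
  ultimately show ?case unfolding forks_def subst.simps by meson
qed (auto simp: forks_def step_Choice_iff)

lemma forks_phi:
  assumes "forks l p" "\<forall>r. \<not> step p Tau r" "WB q p" "WB q (phi l n) \<or> (\<exists>i. WB q (pw l i))"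
  shows "WB p (phi l n)"
  using assms forks_not_pw WB_trans WB_sym by metis

text \<open>Total depth 1 means that one partner is bisimilar to \<open>pw l 1\<close> and the
  others are null. Letting that partner move shows the component with \<open>x\<close> to be
  bisimilar to a derivative permitted by \<open>summands\<close>, and its fork leaves only
  \<open>phi l n\<close>.\<close>

lemma expo_1_par_summand:
  assumes "expo \<sigma> x k t" "k = 1" "forks l (\<sigma> x)" "summands l n (subst \<sigma> t)"
  shows "par_summand l n (subst \<sigma> t)"
  using assms
proof (induction rule: expo.induct)
  case (parL k t u)
  let ?p = "subst \<sigma> t" and ?q = "subst \<sigma> u"
  have P: "summands l n (Par ?p ?q)" using parL.prems by simp
  then have only: "only l ?p" "only l ?q" "process ?p" "process ?q" by (auto simp: derivs_def)
  have stable: "\<forall>r. \<not> step ?p Tau r" "\<forall>r. \<not> step ?q Tau r"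
    using derivs_stable[OF P] by (blast intro: step.parL step.parR)+
  show ?case
  proof (cases k)
    case 0
    then have d: "depth ?q = 1" using parL.prems(1) by simp
    then have q: "WB ?q (pw l 1)" by (rule depth_1[OF only(2,4) stable(2)])
    \<comment> \<open>After this step the partner is null, so the derivative of the whole is
      bisimilar to \<open>?p\<close> alone.\<close>
    obtain r where r: "step ?q (Vis l) r"
      using not_null_step[OF only(2,4) stable(2)] d WB_Zero_depth[of ?q] by force
    have "WB r Zero"
      using depth_step[OF r only(2)] only_step[OF r only(2)] process_step[OF r only(4)] d
      by (intro WB_Zero) auto
    then have "WB (Par ?p r) ?p" using only(3) by (rule WB_Par_null2)
    moreover have "WB (Par ?p r) (phi l n) \<or> (\<exists>i. WB (Par ?p r) (pw l i))"
      using P step.parR[OF r] unfolding derivs_def by blast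
    moreover have "forks l ?p" by (rule expo_forks[OF parL.hyps 0 parL.prems(2) only(1,3)])
    ultimately have "WB ?p (phi l n)" using forks_phi stable(1) by blast
    with q show ?thesis by simp
  next
    case (Suc m)
    then have "k = 1" "WB ?q Zero" using parL.prems(1) only by (auto intro: WB_Zero)
    then show ?thesis using parL.IH parL.prems(2) derivs_Par2[OF P] by simp
  qed
next
  case (parR k t u)
  let ?p = "subst \<sigma> t" and ?q = "subst \<sigma> u"
  have P: "summands l n (Par ?q ?p)" using parR.prems by simp
  then have only: "only l ?p" "only l ?q" "process ?p" "process ?q" by (auto simp: derivs_def)
  have stable: "\<forall>r. \<not> step ?p Tau r" "\<forall>r. \<not> step ?q Tau r"
    using derivs_stable[OF P] by (blast intro: step.parL step.parR)+
  show ?case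
  proof (cases k)
    case 0
    then have d: "depth ?q = 1" using parR.prems(1) by simp
    then have q: "WB ?q (pw l 1)" by (rule depth_1[OF only(2,4) stable(2)])
    obtain r where r: "step ?q (Vis l) r"
      using not_null_step[OF only(2,4) stable(2)] d WB_Zero_depth[of ?q] by force
    have "WB r Zero"
      using depth_step[OF r only(2)] only_step[OF r only(2)] process_step[OF r only(4)] d
      by (intro WB_Zero) auto
    then have "WB (Par r ?p) ?p" using only(3) by (rule WB_Par_null1)
    moreover have "WB (Par r ?p) (phi l n) \<or> (\<exists>i. WB (Par r ?p) (pw l i))"
      using P step.parL[OF r] unfolding derivs_def by blast
    moreover have "forks l ?p" by (rule expo_forks[OF parR.hyps 0 parR.prems(2) only(1,3)])
    ultimately have "WB ?p (phi l n)" using forks_phi stable(1) by blast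
    with q show ?thesis by simp
  next
    case (Suc m)
    then have "k = 1" "WB ?q Zero" using parR.prems(1) only by (auto intro: WB_Zero)
    then show ?thesis using parR.IH parR.prems(2) derivs_Par1[OF P] by simp
  qed
qed (auto simp: derivs_Choice)

text \<open>By \<open>expo_sound\<close> the variable found by \<open>par_summand_subst\<close>
  keeps its partner depth on the other side. A process with a parallel summand has depth above 0 and
  a forking one has depth above 1, which is the bound required there.\<close>

lemma sound_par_summand:
  assumes "sound t u" "sz t < n" "\<forall>x. process (\<sigma> x)" "summands l n (subst \<sigma> t)"
    and "par_summand l n (subst \<sigma> t)"
  shows "par_summand l n (subst \<sigma> u)"
proof -
  have only: "only l (subst \<sigma> t)" using assms(4) by (simp add: derivs_def)
  have "RWB (subst \<sigma> t) (subst \<sigma> u)" using assms(1,3) by (simp add: sound_def)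
  then have u: "summands l n (subst \<sigma> u)" using summands_RWB assms(4) by blast
  then have only_u: "only l (subst \<sigma> u)" "process (subst \<sigma> u)" by (simp_all add: derivs_def)
  note transfer = expo_sound[OF assms(1,3) only derivs_stable[OF assms(4)]]
  obtain x where "expo \<sigma> x 0 t \<and> par_summand l n (\<sigma> x) \<or> expo \<sigma> x 1 t \<and> forks l (\<sigma> x)"
    using par_summand_subst[OF assms(5,4,2)] by blast
  then show ?thesis
  proof (elim disjE conjE)
    assume x: "expo \<sigma> x 0 t" "par_summand l n (\<sigma> x)"
    have "0 < depth (\<sigma> x)" using par_summand_depth[OF x(2)] only_subst_var[OF expo_vars[OF x(1)] only] .
    from transfer[OF x(1) this] show ?thesis using expo_par_summand x(2) only_u by blast
  next
    assume x: "expo \<sigma> x 1 t" "forks l (\<sigma> x)"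
    have "1 < depth (\<sigma> x)" using forks_depth[OF x(2)] only_subst_var[OF expo_vars[OF x(1)] only] .
    from transfer[OF x(1) this] show ?thesis using expo_1_par_summand x(2) u by blast
  qed
qed

text \<open>One closing substitution is fixed throughout and composed with that of the axiom at
  \<open>inst\<close>. Soundness moves \<open>summands\<close> to the other side for
  \<open>sym\<close> and \<open>trans\<close>; a prefix never has a parallel summand.\<close>

lemma derivable_par_summand:
  assumes E: "\<forall>(t, u) \<in> E. sound t u \<and> sz t < n \<and> sz u < n" and "derivable E t u"
    and "\<forall>x. process (\<sigma> x)" "summands l n (subst \<sigma> t)"
  shows "par_summand l n (subst \<sigma> t) \<longleftrightarrow> par_summand l n (subst \<sigma> u)"
  using assms(2,4)
proof induction
  case (sym t u)
  then have "sound t u" using derivable_sound[of E] E by blast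
  then have "RWB (subst \<sigma> u) (subst \<sigma> t)" using assms(3) by (simp add: sound_def RWB_sym)
  then show ?case using sym.IH sym.prems summands_RWB by blast
next
  case (trans t u v)
  then have "sound t u" using derivable_sound[of E] E by blast
  then have "RWB (subst \<sigma> t) (subst \<sigma> u)" using assms(3) by (simp add: sound_def)
  then show ?case using trans summands_RWB by blast
next
  case (inst t u \<rho>)
  let ?\<tau> = "\<lambda>x. subst \<sigma> (\<rho> x)"
  have \<tau>: "\<forall>x. process (?\<tau> x)" using assms(3) by (simp add: process_subst)
  have tu: "sound t u" "sz t < n" "sz u < n" using E inst(1) by auto
  then have "RWB (subst ?\<tau> t) (subst ?\<tau> u)" using \<tau> by (simp add: sound_def)
  moreover have t: "summands l n (subst ?\<tau> t)" using inst(2) by (simp add: subst_subst)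
  ultimately have u: "summands l n (subst ?\<tau> u)" using summands_RWB by blast
  show ?case unfolding subst_subst
    using sound_par_summand[OF tu(1,2) \<tau> t] sound_par_summand[OF sound_sym[OF tu(1)] tu(3) \<tau> u] by blast
next
  case (choice t u t' u')
  then show ?case by (simp add: derivs_Choice)
next
  case (par t u t' u')
  then have "sound t u" "sound t' u'" using derivable_sound[of E] E by blast+
  then have "WB (subst \<sigma> t) (subst \<sigma> u)" "WB (subst \<sigma> t') (subst \<sigma> u')"
    using assms(3) by (simp_all add: sound_def RWB_imp_WB)
  \<comment> \<open>The bisimilarity conditions of the \<open>Par\<close> clause depend only on
    classes modulo \<open>WB\<close>. The induction hypotheses are invoked where the other component
    is null, and there \<open>summands\<close> is inherited.\<close>
  then have eq: "WB (subst \<sigma> t) q \<longleftrightarrow> WB (subst \<sigma> u) q" "WB (subst \<sigma> t') q \<longleftrightarrow> WB (subst \<sigma> u') q" for q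
    by (meson WB_trans WB_sym)+
  have P: "summands l n (Par (subst \<sigma> t) (subst \<sigma> t'))" using par.prems by simp
  have "par_summand l n (subst \<sigma> t) \<longleftrightarrow> par_summand l n (subst \<sigma> u)" if "WB (subst \<sigma> t') Zero"
    using par.IH(1) derivs_Par2[OF P that] .
  moreover have "par_summand l n (subst \<sigma> t') \<longleftrightarrow> par_summand l n (subst \<sigma> u')" if "WB (subst \<sigma> t) Zero"
    using par.IH(2) derivs_Par1[OF P that] .
  ultimately show ?case using eq by auto
qed auto

section \<open>The two sides of the law and the contradiction\<close>

lemma summands_lhs: "summands l n (Par (pw l 1) (phi l n))"
  unfolding derivs_def
proof (intro conjI allI impI)
  fix \<mu> q
  assume "step (Par (pw l 1) (phi l n)) \<mu> q"
  then have q: "\<mu> = Vis l \<and> (q = Par Zero (phi l n) \<or> (\<exists>i. q = Par (pw l 1) (pw l i)))"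
    by (rule only_ParE[where l = l]) (auto simp: step_phi)
  then show "\<mu> = Vis l" by blast
  from q show "\<exists>s\<in>insert (phi l n) (range (pw l)). WB q s"
    using WB_Par_Zero[of "phi l n"] WB_pw_Suc[of l] phi_simps(1) by blast
qed auto

lemma par_summand_lhs: "par_summand l n (Par (pw l 1) (phi l n))"
  by (simp add: WB_refl)

text \<open>Every summand is a prefix or \<open>Zero\<close>. The length of \<open>tails\<close> is
  a separate variable so that the induction leaves \<open>phi l n\<close> fixed.\<close>

lemma not_par_summand_rhs: "\<not> par_summand l n (Choice (Prefix (Vis l) (phi l n)) (tails l m))"
  by (induction m) auto

theorem theorem10:
  "\<not> (\<exists>E :: ('a ccs \<times> 'a ccs) set.
        finite E \<and>
        (\<forall>(t, u) \<in> E. sound t u) \<and>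
        (\<forall>t u. sound t u \<longrightarrow> derivable E t u))"
proof
  assume "\<exists>E :: ('a ccs \<times> 'a ccs) set.
    finite E \<and> (\<forall>(t, u) \<in> E. sound t u) \<and> (\<forall>t u. sound t u \<longrightarrow> derivable E t u)"
  then obtain E :: "('a ccs \<times> 'a ccs) set" where "finite E"
    and E: "\<forall>(t, u) \<in> E. sound t u" and complete: "\<And>t u. sound t u \<Longrightarrow> derivable E t u"
    by blast
  \<comment> \<open>Any label serves; \<open>undefined\<close> is some action name.\<close>
  define l :: "'a label" where "l = Name undefined"
  \<comment> \<open>Exceeds the size of both sides of every axiom, since \<open>E\<close> is
    finite.\<close>
  define n where "n = Suc (\<Sum>(t, u) \<in> E. sz t + sz u)"
  have "sz t + sz u < n" if "(t, u) \<in> E" for t u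
    using member_le_sum[OF that, of "\<lambda>(t, u). sz t + sz u"] \<open>finite E\<close> by (simp add: n_def)
  with E have E': "\<forall>(t, u) \<in> E. sound t u \<and> sz t < n \<and> sz u < n" by fastforce
  let ?t = "Par (pw l 1) (phi l n)" and ?u = "Choice (Prefix (Vis l) (phi l n)) (tails l n)"
  have "process ?t" "process ?u" by simp_all
  then have id: "subst \<sigma> ?t = ?t" "subst \<sigma> ?u = ?u" for \<sigma>
    using subst_process by blast+
  have "derivable E ?t ?u" by (rule complete) (simp only: sound_def id phi_law simp_thms)
  moreover have "\<forall>x. process ((\<lambda>_. Zero) x)" by simp
  ultimately show False
    using derivable_par_summand[OF E', of ?t ?u "\<lambda>_. Zero" l] summands_lhs par_summand_lhs
      not_par_summand_rhs unfolding id by blast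
qed

end
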